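(* For every positive integer $d$ there is a Hilbert space norm on $\mathcal D_d$, equivalent to the original one, such that the reproducing kernel of $\mathcal D_d$ with respect to this norm has the complete Nevanlinna–Pick (CNP) property.
   Context: $\mathbb D=\{z\in\mathbb C:|z|<1\}$. $\mathcal D_d$ is the reproducing kernel Hilbert space of holomorphic functions on $\mathbb D$ with reproducing kernel $k(w,z)^d$, where $k(w,z)=\sum_{n=0}^\infty\frac{(\overline zw)^n}{n+1}$ is the kernel of the Dirichlet space. An irreducible kernel $K:X\times X\to\mathbb C$ (that is, $K(x,y)\ne0$ for all $x,y\in X$, and the kernel functions at distinct points are linearly independent) has the CNP property if there are a positive (semi)definite function $F:X\times X\to\mathbb D$ and a nowhere vanishing function $\delta:X\to\mathbb C$ such that $$K(x,y)=\frac{\overline{\delta(x)}\,\delta(y)}{1-F(x,y)}\qquad\text{for all }x,y\in X.$$ The CNP property is a property of the kernel (hence of the chosen norm), not of the space as a set. *)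

theory Defs
  imports "HOL-Complex_Analysis.Complex_Analysis" "HOL-Library.Nonpos_Ints"
begin

text \<open>
  Complex-valued functions on a set \<open>X\<close> are represented by total functions that vanish
  outside \<open>X\<close>, so that equality of functions on \<open>X\<close> is equality in HOL.
  Inner products are linear in the first argument.
\<close>

definition ip_norm :: "(('a \<Rightarrow> complex) \<Rightarrow> ('a \<Rightarrow> complex) \<Rightarrow> complex) \<Rightarrow> ('a \<Rightarrow> complex) \<Rightarrow> real"
  where "ip_norm ip f = sqrt (Re (ip f f))"

locale hilbert_function_space =
  fixes X :: "'a set"
    and H :: "('a \<Rightarrow> complex) set"
    and ip :: "('a \<Rightarrow> complex) \<Rightarrow> ('a \<Rightarrow> complex) \<Rightarrow> complex"
  assumes vanish_outside: "\<And>f x. f \<in> H \<Longrightarrow> x \<notin> X \<Longrightarrow> f x = 0"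
    and zero_closed: "(\<lambda>x. 0) \<in> H"
    and add_closed: "\<And>f g. f \<in> H \<Longrightarrow> g \<in> H \<Longrightarrow> (\<lambda>x. f x + g x) \<in> H"
    and scale_closed: "\<And>c f. f \<in> H \<Longrightarrow> (\<lambda>x. c * f x) \<in> H"
    and ip_add: "\<And>f g h. f \<in> H \<Longrightarrow> g \<in> H \<Longrightarrow> h \<in> H \<Longrightarrow>
                   ip (\<lambda>x. f x + g x) h = ip f h + ip g h"
    and ip_scale: "\<And>c f g. f \<in> H \<Longrightarrow> g \<in> H \<Longrightarrow> ip (\<lambda>x. c * f x) g = c * ip f g"
    and ip_cnj: "\<And>f g. f \<in> H \<Longrightarrow> g \<in> H \<Longrightarrow> ip g f = cnj (ip f g)"
    and ip_nonneg: "\<And>f. f \<in> H \<Longrightarrow> ip f f \<in> \<real>\<^sub>\<ge>\<^sub>0"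
    and ip_definite: "\<And>f. f \<in> H \<Longrightarrow> ip f f = 0 \<Longrightarrow> f = (\<lambda>x. 0)"
    and complete: "\<And>u :: nat \<Rightarrow> 'a \<Rightarrow> complex.
        (\<And>n. u n \<in> H) \<Longrightarrow>
        (\<And>e. e > 0 \<Longrightarrow> \<exists>N. \<forall>m\<ge>N. \<forall>n\<ge>N. ip_norm ip (\<lambda>x. u m x - u n x) < e) \<Longrightarrow>
        \<exists>f\<in>H. (\<lambda>n. ip_norm ip (\<lambda>x. u n x - f x)) \<longlonglongrightarrow> 0"

definition kernel_fun :: "'a set \<Rightarrow> ('a \<Rightarrow> 'a \<Rightarrow> complex) \<Rightarrow> 'a \<Rightarrow> 'a \<Rightarrow> complex"
  where "kernel_fun X K y = (\<lambda>x. if x \<in> X then K x y else 0)"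

definition reproducing_kernel ::
    "'a set \<Rightarrow> ('a \<Rightarrow> complex) set \<Rightarrow> (('a \<Rightarrow> complex) \<Rightarrow> ('a \<Rightarrow> complex) \<Rightarrow> complex) \<Rightarrow>
     ('a \<Rightarrow> 'a \<Rightarrow> complex) \<Rightarrow> bool"
  where "reproducing_kernel X H ip K \<longleftrightarrow>
    (\<forall>y\<in>X. kernel_fun X K y \<in> H \<and> (\<forall>f\<in>H. f y = ip f (kernel_fun X K y)))"

definition equivalent_norms :: "'f set \<Rightarrow> ('f \<Rightarrow> real) \<Rightarrow> ('f \<Rightarrow> real) \<Rightarrow> bool"
  where "equivalent_norms H N N' \<longleftrightarrow>
    (\<exists>a>0. \<exists>b>0. \<forall>f\<in>H. a * N f \<le> N' f \<and> N' f \<le> b * N f)"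

text \<open>Membership of the sum in \<open>\<real>\<^sub>\<ge>\<^sub>0\<close> includes that it is real.\<close>

definition pos_semidef :: "'a set \<Rightarrow> ('a \<Rightarrow> 'a \<Rightarrow> complex) \<Rightarrow> bool"
  where "pos_semidef X F \<longleftrightarrow>
    (\<forall>S c. finite S \<and> S \<subseteq> X \<longrightarrow> (\<Sum>x\<in>S. \<Sum>y\<in>S. c x * cnj (c y) * F x y) \<in> \<real>\<^sub>\<ge>\<^sub>0)"

definition irreducible_kernel :: "'a set \<Rightarrow> ('a \<Rightarrow> 'a \<Rightarrow> complex) \<Rightarrow> bool"
  where "irreducible_kernel X K \<longleftrightarrow>
    pos_semidef X K \<and>
    (\<forall>x\<in>X. \<forall>y\<in>X. K x y \<noteq> 0) \<and>
    (\<forall>S c. finite S \<and> S \<subseteq> X \<and> (\<forall>x\<in>X. (\<Sum>y\<in>S. c y * K x y) = 0) \<longrightarrow> (\<forall>y\<in>S. c y = 0))"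

definition CNP_kernel :: "'a set \<Rightarrow> ('a \<Rightarrow> 'a \<Rightarrow> complex) \<Rightarrow> bool"
  where "CNP_kernel X K \<longleftrightarrow>
    irreducible_kernel X K \<and>
    (\<exists>F \<delta>. pos_semidef X F \<and> (\<forall>x\<in>X. \<forall>y\<in>X. norm (F x y) < 1) \<and> (\<forall>x\<in>X. \<delta> x \<noteq> 0) \<and>
       (\<forall>x\<in>X. \<forall>y\<in>X. K x y = cnj (\<delta> x) * \<delta> y / (1 - F x y)))"

abbreviation unit_disc :: "complex set"  (\<open>\<D>\<close>)
  where "\<D> \<equiv> ball 0 1"

definition dirichlet_kernel :: "complex \<Rightarrow> complex \<Rightarrow> complex"
  where "dirichlet_kernel w z = (\<Sum>n. (cnj z * w) ^ n / of_nat (n + 1))"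

text \<open>A reproducing kernel determines its space of functions together with the inner product,
  so for each \<open>d\<close> the following predicate describes a single pair \<open>(H, ip)\<close>, up to the
  irrelevant values of \<open>ip\<close> outside \<open>H \<times> H\<close>.\<close>

definition is_dirichlet_power_space ::
    "nat \<Rightarrow> (complex \<Rightarrow> complex) set \<Rightarrow>
     ((complex \<Rightarrow> complex) \<Rightarrow> (complex \<Rightarrow> complex) \<Rightarrow> complex) \<Rightarrow> bool"
  where "is_dirichlet_power_space d H ip \<longleftrightarrow>
    hilbert_function_space \<D> H ip \<and>
    (\<forall>f\<in>H. f holomorphic_on \<D>) \<and>
    reproducing_kernel \<D> H ip (\<lambda>w z. dirichlet_kernel w z ^ d)"

end

theory Submission
  imports Defs
begin

text \<open>
  The kernel of \<open>\<D>\<^sub>d\<close> is diagonal, \<open>\<Sum>n. a n * (cnj z * w) ^ n\<close>, and Cauchy products give by induction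
  that \<open>a n\<close> is comparable to \<open>(harm n + C) ^ (d - 1) / (n + 1)\<close> for every \<open>C \<ge> 1\<close>. If \<open>C\<close> is large
  compared with \<open>d\<close>, the latter sequence is log-convex, so by Kaluza's lemma the diagonal kernel built
  from it (normalised to \<open>b 0 = 1\<close>) is of the form \<open>1 / (1 - F)\<close> with \<open>F\<close> having nonnegative Taylor
  coefficients. Finally, a Hilbert space with diagonal kernel consists of the power series
  \<open>\<Sum>n. p n * z ^ n\<close> with \<open>\<Sum>n. \<bar>p n\<bar>\<^sup>2 / a n\<close> finite, this sum being the squared norm; replacing \<open>a\<close> by
  \<open>b\<close> in it gives the equivalent norm.
\<close>

subsection \<open>Log-convex sequences and coefficients of kernel powers\<close>

text \<open>Kaluza's lemma needs log-convexity, a delicate relation between neighbouring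
  coefficients, whereas Cauchy products are estimated here only up to constant factors. An
  equivalent norm tolerates exactly such factors, so the true coefficients can be traded for an
  explicit sequence of the same size. In that sequence the factor \<open>1 / (n + 1)\<close> is
  log-convex and the power of \<open>harm n + C\<close> is log-concave. Both effects are of relative
  order \<open>1 / n ^ 2\<close>, but the second carries an extra factor of about
  \<open>m / (harm n + C)\<close> for the exponent \<open>m\<close>. The shift \<open>C\<close>
  makes this factor small already at \<open>n = 0\<close>. The space is given only through its
  kernel, with no formula for its norm. The coefficient formula has to be extracted from the
  reproducing property, and the first obstacle is that the monomials must be shown to lie in
  \<open>H\<close>. This and the existence of functions with prescribed coefficients rest on one
  criterion: a sequence converges once its Gram matrix does.\<close>

text \<open>Log-convexity makes the ratios \<open>b (Suc n) / b n\<close> increase; the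
  cross-multiplied form is what the induction in Kaluza's lemma consumes.\<close>

lemma log_convex_ratio_mono:
  fixes b :: "nat \<Rightarrow> real"
  assumes pos: "\<And>n. 0 < b n" and logconv: "\<And>n. b (Suc n) ^ 2 \<le> b n * b (Suc (Suc n))"
    and "j \<le> m"
  shows "b (Suc j) * b m \<le> b j * b (Suc m)"
  using \<open>j \<le> m\<close>
proof (induction m rule: dec_induct)
  case base
  show ?case by simp
next
  case (step m)
  have "b m * (b (Suc j) * b (Suc m)) = (b (Suc j) * b m) * b (Suc m)" by simp
  also have "\<dots> \<le> (b j * b (Suc m)) * b (Suc m)"
    using step.IH pos by (intro mult_right_mono) (auto intro: less_imp_le)
  also have "\<dots> = b j * b (Suc m) ^ 2" by (simp add: power2_eq_square)
  also have "\<dots> \<le> b j * (b m * b (Suc (Suc m)))"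
    using logconv pos by (intro mult_left_mono) (auto intro: less_imp_le)
  finally have "b m * (b (Suc j) * b (Suc m)) \<le> b m * (b j * b (Suc (Suc m)))"
    by (simp add: algebra_simps)
  then show ?case using pos by simp
qed

text \<open>The \<open>c n\<close> are the coefficients of \<open>1 - 1 / B\<close> for the
  generating function \<open>B\<close> of \<open>b\<close>. Nonnegativity comes from multiplying the
  recursion at \<open>m\<close> by \<open>b (Suc m)\<close>, the one at \<open>Suc m\<close> by
  \<open>b m\<close>, and subtracting: each earlier \<open>c k\<close> then meets a difference that
  is nonnegative by monotone ratios. The bound by \<open>b n\<close> later gives convergence of the
  series of \<open>c\<close> on the disc.\<close>

lemma Kaluza:
  fixes b :: "nat \<Rightarrow> real"
  assumes b0: "b 0 = 1" and pos: "\<And>n. 0 < b n"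
    and logconv: "\<And>n. b (Suc n) ^ 2 \<le> b n * b (Suc (Suc n))"
  obtains c where "c 0 = 0" "\<And>n. 0 \<le> c n" "\<And>n. c n \<le> b n"
    "\<And>n. n > 0 \<Longrightarrow> b n = (\<Sum>k\<le>n. c k * b (n - k))"
proof -
  define B where "B = Abs_fps b"
  define c where "c n = fps_nth (1 - inverse B) n" for n
  have B0: "fps_nth B 0 \<noteq> 0" by (simp add: B_def b0)
  then have "(1 - inverse B) * B = B - 1"
    by (simp add: algebra_simps inverse_mult_eq_1')
  then have conv: "(\<Sum>k\<le>n. c k * b (n - k)) = fps_nth (B - 1) n" for n
    by (metis (no_types, lifting) B_def atLeast0AtMost c_def fps_mult_nth fps_nth_Abs_fps sum.cong)
  have c0: "c 0 = 0" using conv[of 0] b0 by (simp add: B_def)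
  have rec: "b n = (\<Sum>k\<le>n. c k * b (n - k))" if "n > 0" for n
    using conv[of n] that by (simp add: B_def)
  have nonneg: "0 \<le> c n" for n
  proof (induction n rule: less_induct)
    case (less n)
    \<comment> \<open>Index 1 is separate: the step to \<open>Suc m\<close> uses the recursion at
      \<open>m\<close>, which fails at 0, where the sum vanishes but \<open>b 0 = 1\<close>.\<close>
    consider "n = 0" | "n = 1" | m where "n = Suc m" "m > 0"
      by (metis One_nat_def not0_implies_Suc zero_less_iff_neq_zero)
    then show ?case
    proof cases
      case 1
      then show ?thesis using c0 by simp
    next
      case 2
      then show ?thesis using rec[of 1] pos[of 1] c0 b0 by simp
    next
      case (3 m)
      have "b (Suc m) = (\<Sum>k\<le>m. c k * b (Suc m - k)) + c (Suc m)"
        using rec[of "Suc m"] b0 by simp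
      then have "b m * c (Suc m) = b m * b (Suc m) - (\<Sum>k\<le>m. c k * b (Suc m - k)) * b m"
        by (simp add: algebra_simps)
      also have "b m * b (Suc m) = (\<Sum>k\<le>m. c k * b (m - k)) * b (Suc m)"
        using rec[OF \<open>m > 0\<close>] by simp
      also have "\<dots> - (\<Sum>k\<le>m. c k * b (Suc m - k)) * b m
          = (\<Sum>k\<le>m. c k * (b (m - k) * b (Suc m) - b (Suc (m - k)) * b m))"
        unfolding sum_distrib_right sum_subtractf[symmetric]
        by (intro sum.cong) (auto simp: algebra_simps Suc_diff_le)
      also have "\<dots> \<ge> 0"
      proof (intro sum_nonneg mult_nonneg_nonneg)
        fix k assume k: "k \<in> {..m}"
        then show "0 \<le> c k" using less 3 by simp
        show "0 \<le> b (m - k) * b (Suc m) - b (Suc (m - k)) * b m"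
          using log_convex_ratio_mono[of b, OF pos logconv, of "m - k" m] by simp
      qed
      finally have "0 \<le> b m * c (Suc m)" .
      then show ?thesis using pos[of m] 3 by (simp add: zero_le_mult_iff)
    qed
  qed
  have "c n \<le> b n" for n
  proof (cases "n = 0")
    case True
    then show ?thesis using c0 b0 by simp
  next
    case False
    have "c n * b (n - n) \<le> (\<Sum>k\<le>n. c k * b (n - k))"
      by (rule member_le_sum) (use nonneg pos in \<open>auto intro!: mult_nonneg_nonneg intro: less_imp_le\<close>)
    then show ?thesis using rec[of n] False b0 by simp
  qed
  with that c0 nonneg rec show ?thesis by blast
qed

text \<open>With \<open>x = harm (Suc n) + C\<close> and \<open>N = n + 1\<close>, the bases at
  \<open>n\<close> and \<open>n + 2\<close> multiply to \<open>x ^ 2 * (1 - u)\<close>, so the claim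
  becomes \<open>(1 - u) ^ m \<ge> 1 - 1 / (N + 1) ^ 2\<close>. By Bernoulli it suffices that
  \<open>m * u \<le> 1 / (N + 1) ^ 2\<close>. As \<open>u\<close> is at most
  \<open>2 / (x * N * (N + 1))\<close> and \<open>N + 1 \<le> 2 * N\<close>, the condition
  \<open>x \<ge> 4 * m\<close> is enough; the extra 1 in the bound on \<open>C\<close> ensures
  \<open>x \<ge> 1\<close>.\<close>

lemma harm_power_log_convex:
  fixes C :: real and m n :: nat
  assumes C: "4 * real m + 1 \<le> C"
  defines "b \<equiv> \<lambda>n. (harm n + C) ^ m / real (n + 1)"
  shows "b (Suc n) ^ 2 \<le> b n * b (Suc (Suc n))"
proof -
  define N where "N = real n + 1"
  define x where "x = harm (Suc n) + C"
  define u where "u = (1 / x + 1 / x ^ 2) / (N * (N + 1))"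
  have N: "N \<ge> 1" by (simp add: N_def)
  have x1: "x \<ge> C" using harm_nonneg[of "Suc n", where 'a = real] by (simp add: x_def)
  then have x: "x \<ge> 1" "x \<ge> 4 * real m" using C by linarith+
  have eq1: "harm n + C = x - 1 / N"
    by (simp add: x_def N_def harm_Suc inverse_eq_divide add.commute)
  have eq2: "harm (Suc (Suc n)) + C = x + 1 / (N + 1)"
    by (simp add: x_def N_def harm_Suc inverse_eq_divide algebra_simps)
  have prod: "(x - 1 / N) * (x + 1 / (N + 1)) = x ^ 2 * (1 - u)"
  proof -
    have "x ^ 2 * u = (x + 1) / (N * (N + 1))"
    proof -
      have "x ^ 2 * (1 / x + 1 / x ^ 2) = x + 1"
        using x by (simp add: field_simps power2_eq_square)
      then show ?thesis by (simp only: u_def times_divide_eq_right)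
    qed
    moreover have "(x - 1 / N) * (x + 1 / (N + 1)) = x ^ 2 - (x + 1) / (N * (N + 1))"
    proof -
      have "1 / N - 1 / (N + 1) = 1 / (N * (N + 1))" "1 / N * (1 / (N + 1)) = 1 / (N * (N + 1))"
        using N by (simp_all add: divide_simps)
      moreover have "(x - 1 / N) * (x + 1 / (N + 1))
          = x ^ 2 - x * (1 / N - 1 / (N + 1)) - 1 / N * (1 / (N + 1))"
        by (simp only: algebra_simps power2_eq_square)
      ultimately show ?thesis by (simp only: add_divide_distrib) simp
    qed
    ultimately show ?thesis by (simp add: algebra_simps)
  qed
  have "1 / x ^ 2 \<le> 1 / x"
    using x by (simp add: field_simps power2_eq_square)
  then have u_le: "u \<le> (2 / x) / (N * (N + 1))"
    unfolding u_def using N by (intro divide_right_mono) auto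
  have "real m * (2 / x) \<le> 1 / 2"
    using x by (simp add: field_simps)
  then have "real m * u \<le> (1 / 2) / (N * (N + 1))"
    using mult_left_mono[OF u_le, of "real m"] N
    by (smt (verit) divide_right_mono mult_nonneg_nonneg of_nat_0_le_iff times_divide_eq_right)
  also have "\<dots> = 1 / (2 * N * (N + 1))" by simp
  also have "\<dots> \<le> 1 / (N + 1) ^ 2"
    unfolding power2_eq_square using N by (intro divide_left_mono mult_right_mono) auto
  finally have mu: "real m * u \<le> 1 / (N + 1) ^ 2" .
  \<comment> \<open>Bernoulli's inequality is applied to \<open>- u\<close>, which must be at least
    -1.\<close>
  have "2 / x \<le> 2" using x by (simp add: field_simps)
  moreover have "N * (N + 1) \<ge> 2" using mult_mono[of 1 N 2 "N + 1"] N by simp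
  ultimately have "2 / x \<le> N * (N + 1)" by linarith
  then have "(2 / x) / (N * (N + 1)) \<le> 1"
    using \<open>N * (N + 1) \<ge> 2\<close> by (subst divide_le_eq_1_pos) auto
  then have "u \<le> 1" using u_le by linarith
  then have bern: "1 - real m * u \<le> (1 - u) ^ m"
    using Bernoulli_inequality[of "- u" m] by simp
  have "N * (N + 2) = (N + 1) ^ 2 - 1"
    by (simp add: power2_eq_square algebra_simps)
  then have "N * (N + 2) / (N + 1) ^ 2 = 1 - 1 / (N + 1) ^ 2"
    using N by (simp add: diff_divide_distrib)
  also have "\<dots> \<le> (1 - u) ^ m" using bern mu by linarith
  finally have key: "N * (N + 2) / (N + 1) ^ 2 \<le> (1 - u) ^ m" .
  have "b (Suc n) ^ 2 = x ^ (2 * m) / (N + 1) ^ 2"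
    by (simp add: b_def x_def N_def power_divide power_mult[symmetric] mult.commute algebra_simps)
  also have "\<dots> = x ^ (2 * m) / (N * (N + 2)) * (N * (N + 2) / (N + 1) ^ 2)"
    using N by simp
  also have "\<dots> \<le> x ^ (2 * m) / (N * (N + 2)) * (1 - u) ^ m"
    using key N x by (intro mult_left_mono) auto
  also have "\<dots> = (x ^ 2 * (1 - u)) ^ m / (N * (N + 2))"
    by (simp add: power_mult_distrib power_mult)
  also have "N * (N + 2) = real (n + 1) * real (Suc (Suc n) + 1)"
    by (simp add: N_def algebra_simps)
  also have "(x ^ 2 * (1 - u)) ^ m / (real (n + 1) * real (Suc (Suc n) + 1)) = b n * b (Suc (Suc n))"
    unfolding prod[symmetric] b_def eq1[symmetric] eq2[symmetric]
    by (simp only: power_mult_distrib times_divide_times_eq)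
  finally show ?thesis .
qed

section \<open>Growth of the coefficients of powers of the Dirichlet kernel\<close>

text \<open>Partial fractions: the two factors in each denominator add up to \<open>n + 2\<close>,
  and the reflection of \<open>k\<close> to \<open>n - k\<close> identifies the two resulting
  harmonic sums.\<close>

lemma sum_reciprocal_products:
  "(\<Sum>k\<le>n. 1 / (real (k + 1) * real (n - k + 1))) = 2 * harm (Suc n) / real (n + 2)"
proof -
  have h: "harm (Suc n) = (\<Sum>k\<le>n. 1 / real (k + 1))"
    by (simp add: harm_altdef lessThan_Suc_atMost inverse_eq_divide)
  have h': "harm (Suc n) = (\<Sum>k\<le>n. 1 / real (n - k + 1))"
    unfolding h by (rule sum.reindex_bij_witness[of _ "\<lambda>k. n - k" "\<lambda>k. n - k"]) auto
  have "(\<Sum>k\<le>n. 1 / (real (k + 1) * real (n - k + 1)))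
      = (\<Sum>k\<le>n. (1 / real (k + 1) + 1 / real (n - k + 1)) / real (n + 2))"
  proof (intro sum.cong refl)
    fix k assume "k \<in> {..n}"
    then have e: "real (n + 2) = real (k + 1) + real (n - k + 1)"
      by (simp flip: of_nat_add)
    have p: "real (k + 1) > 0" "real (n - k + 1) > 0" by auto
    show "1 / (real (k + 1) * real (n - k + 1))
        = (1 / real (k + 1) + 1 / real (n - k + 1)) / real (n + 2)"
      unfolding e using p by (auto simp: divide_simps)
  qed
  also have "\<dots> = ((\<Sum>k\<le>n. 1 / real (k + 1)) + (\<Sum>k\<le>n. 1 / real (n - k + 1))) / real (n + 2)"
    by (simp only: sum_divide_distrib[symmetric] sum.distrib)
  also have "\<dots> = 2 * harm (Suc n) / real (n + 2)"
    using h h' by simp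
  finally show ?thesis .
qed

text \<open>At most \<open>k\<close> terms lie between the two harmonic numbers, each at most
  \<open>1 / (k + 1)\<close>. This slow variation makes the weights on the upper half of a
  convolution comparable to the last one.\<close>

lemma harm_le_half:
  assumes "n \<le> 2 * k"
  shows "harm n \<le> harm k + (1 :: real)"
proof (cases "n \<le> k")
  case True
  then show ?thesis using harm_mono[of n k, where 'a = real] by simp
next
  case False
  then have "harm n - harm k = (\<Sum>i\<in>{k..<n}. inverse (real (Suc i)))"
    unfolding harm_altdef using sum.atLeastLessThan_concat[of 0 k n "\<lambda>i. inverse (real (Suc i))"]
    by (simp add: lessThan_atLeast0 algebra_simps)
  also have "\<dots> \<le> (\<Sum>i\<in>{k..<n}. inverse (real (Suc k)))"
    by (intro sum_mono) (auto simp: field_simps)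
  also have "\<dots> = real (n - k) / real (Suc k)" by (simp add: inverse_eq_divide)
  also have "\<dots> \<le> 1" using assms False by (simp add: divide_simps)
  finally show ?thesis by simp
qed

text \<open>For the upper bound every weight is replaced by the largest one. For the lower bound
  only the indices \<open>k\<close> with \<open>n \<le> 2 * k\<close> are kept: there
  \<open>harm k + C\<close> is at least half of \<open>harm n + C\<close>, which costs
  \<open>2 ^ m\<close>, and by symmetry these indices carry at least half of the unweighted
  sum.\<close>

lemma dirichlet_power_conv_bounds:
  fixes C :: real and m n :: nat
  assumes C: "C \<ge> 1"
  defines "w \<equiv> \<lambda>m n. (harm n + C) ^ m / real (n + 1)"
  shows "(\<Sum>k\<le>n. w m k * (1 / real (n - k + 1))) \<le> 2 * w (Suc m) n"
    and "w (Suc m) n \<le> 2 ^ (m + 1) * (C + 1) * (\<Sum>k\<le>n. w m k * (1 / real (n - k + 1)))"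
proof -
  let ?q = "\<lambda>k. 1 / (real (k + 1) * real (n - k + 1))"
  have hC: "harm k + C \<ge> 1" for k using harm_nonneg[of k, where 'a = real] C by linarith
  have eq: "(\<Sum>k\<le>n. w m k * (1 / real (n - k + 1))) = (\<Sum>k\<le>n. (harm k + C) ^ m * ?q k)"
    by (simp add: w_def)
  have "(\<Sum>k\<le>n. (harm k + C) ^ m * ?q k) \<le> (\<Sum>k\<le>n. (harm n + C) ^ m * ?q k)"
    using hC C harm_nonneg[where 'a = real]
    by (intro sum_mono mult_right_mono power_mono) (auto simp: harm_mono)
  also have "\<dots> = (harm n + C) ^ m * (2 * harm (Suc n) / real (n + 2))"
    by (simp only: sum_distrib_left[symmetric] sum_reciprocal_products)
  also have "\<dots> \<le> (harm n + C) ^ m * (2 * (harm n + C) / real (n + 1))"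
  proof (rule mult_left_mono, rule frac_le)
    have "inverse (real (Suc n)) \<le> 1" by (simp add: inverse_eq_divide)
    then show "2 * harm (Suc n) \<le> 2 * (harm n + C)"
      using C unfolding harm_Suc by (intro mult_left_mono add_left_mono) auto
  qed (use hC[of n] in auto)
  finally show "(\<Sum>k\<le>n. w m k * (1 / real (n - k + 1))) \<le> 2 * w (Suc m) n"
    unfolding eq by (simp only: w_def power_Suc times_divide_eq_right mult_ac)
next
  let ?q = "\<lambda>k. 1 / (real (k + 1) * real (n - k + 1))"
  have hC: "harm k + C \<ge> 1" for k using harm_nonneg[of k, where 'a = real] C by linarith
  let ?A = "{k. k \<le> n \<and> n \<le> 2 * k}" and ?B = "{k. k \<le> n \<and> 2 * k \<le> n}"
  \<comment> \<open>Reflection exchanges \<open>?A\<close> and \<open>?B\<close>. They overlap at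
    the midpoint when \<open>n\<close> is even, hence an inequality.\<close>
  have "sum ?q {..n} \<le> sum ?q (?A \<union> ?B)" by (intro sum_mono2) auto
  also have "\<dots> \<le> sum ?q ?A + sum ?q ?B"
    using sum.union_inter[of ?A ?B ?q] sum_nonneg[of "?A \<inter> ?B" ?q] by auto
  also have "sum ?q ?B = sum ?q ?A"
    by (rule sum.reindex_bij_witness[of _ "\<lambda>k. n - k" "\<lambda>k. n - k"]) (auto simp: mult.commute)
  finally have half: "harm (Suc n) / real (n + 2) \<le> sum ?q ?A"
    unfolding sum_reciprocal_products by simp
  have h1: "harm (Suc n) \<ge> (1::real)"
    using harm_mono[of "Suc 0" "Suc n", where 'a = real] by (simp add: harm_expand)
  \<comment> \<open>The factor \<open>2 * (C + 1)\<close> arises here: \<open>C + 1\<close> from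
    \<open>harm (Suc n) \<ge> 1\<close>, and 2 from \<open>n + 2 \<le> 2 * (n + 1)\<close>.\<close>
  have "harm n + C \<le> harm (Suc n) + C * harm (Suc n)"
    using h1 C harm_mono[of n "Suc n", where 'a = real] by (intro add_mono) auto
  then have "(harm n + C) / real (n + 1) \<le> (C + 1) * harm (Suc n) / real (n + 1)"
    by (intro divide_right_mono) (auto simp: algebra_simps)
  also have "\<dots> \<le> (C + 1) * harm (Suc n) / (real (n + 2) / 2)"
    using C h1 by (intro divide_left_mono) auto
  also have "\<dots> = 2 * (C + 1) * (harm (Suc n) / real (n + 2))" by simp
  also have "\<dots> \<le> 2 * (C + 1) * sum ?q ?A" using half C by (intro mult_left_mono) auto
  finally have *: "(harm n + C) / real (n + 1) \<le> 2 * (C + 1) * sum ?q ?A" .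
  have "w (Suc m) n = (harm n + C) ^ m * ((harm n + C) / real (n + 1))"
    by (simp add: w_def)
  also have "\<dots> \<le> (harm n + C) ^ m * (2 * (C + 1) * sum ?q ?A)"
    using * hC[of n] by (intro mult_left_mono) auto
  also have "\<dots> = 2 * (C + 1) * (\<Sum>k\<in>?A. (harm n + C) ^ m * ?q k)"
    by (simp add: sum_distrib_left mult_ac)
  also have "\<dots> \<le> 2 * (C + 1) * (\<Sum>k\<in>?A. (2 * (harm k + C)) ^ m * ?q k)"
  proof -
    have "harm n + C \<le> 2 * (harm k + C)" if "n \<le> 2 * k" for k
      using add_mono[OF harm_le_half[OF that] order_refl[of C]] hC[of k] unfolding mult_2 by linarith
    then show ?thesis using C hC[of n]
      by (intro mult_left_mono sum_mono mult_right_mono power_mono) auto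
  qed
  also have "\<dots> \<le> 2 * (C + 1) * (\<Sum>k\<le>n. (2 * (harm k + C)) ^ m * ?q k)"
  proof -
    have "0 \<le> (2 * (harm k + C)) ^ m * ?q k" for k
      using hC[of k] by (intro mult_nonneg_nonneg zero_le_power) auto
    then have "(\<Sum>k\<in>?A. (2 * (harm k + C)) ^ m * ?q k) \<le> (\<Sum>k\<le>n. (2 * (harm k + C)) ^ m * ?q k)"
      by (rule sum_mono2[rotated 2]) auto
    then show ?thesis using C by (intro mult_left_mono) auto
  qed
  also have "\<dots> = 2 ^ (m + 1) * (C + 1) * (\<Sum>k\<le>n. w m k * (1 / real (n - k + 1)))"
    by (simp add: w_def sum_distrib_left power_mult_distrib mult_ac del: distrib_left_numeral distrib_right_numeral)
  finally show "w (Suc m) n \<le> 2 ^ (m + 1) * (C + 1) * (\<Sum>k\<le>n. w m k * (1 / real (n - k + 1)))" .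
qed

lemma summable_geometric_harmonic:
  fixes x :: complex
  assumes "norm x < 1"
  shows "summable (\<lambda>n. norm (x ^ n / of_nat (n + 1)))"
proof (rule summable_comparison_test)
  show "\<exists>N. \<forall>n\<ge>N. norm (norm (x ^ n / of_nat (n + 1))) \<le> norm x ^ n"
    by (auto simp: norm_divide norm_power divide_le_eq mult_le_cancel_left1 simp del: of_nat_Suc)
  show "summable (\<lambda>n. norm x ^ n)" using assms by (simp add: summable_geometric)
qed

text \<open>Each further factor of the kernel convolves the coefficients with
  \<open>1 / (n + 1)\<close> and so contributes one factor \<open>harm n + C\<close>. The shift
  \<open>C\<close> stays fixed during the induction, so it can be chosen according to the final
  exponent; only the constants \<open>l\<close> and \<open>u\<close> deteriorate.\<close>

lemma dirichlet_power_coeffs: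
  fixes C :: real and m :: nat
  assumes C: "C \<ge> 1"
  shows "\<exists>a l u. 0 < l \<and> 0 < u \<and>
    (\<forall>n. l * ((harm n + C) ^ m / real (n + 1)) \<le> a n \<and> a n \<le> u * ((harm n + C) ^ m / real (n + 1))) \<and>
    (\<forall>x::complex. norm x < 1 \<longrightarrow>
       (\<lambda>n. of_real (a n) * x ^ n) sums (\<Sum>n. x ^ n / of_nat (n + 1)) ^ (Suc m))"
proof (induction m)
  case 0
  have "(\<lambda>n. of_real (1 / real (n + 1)) * x ^ n) sums (\<Sum>n. x ^ n / of_nat (n + 1)) ^ Suc 0"
    if "norm x < 1" for x :: complex
    using summable_sums[OF summable_norm_cancel[OF summable_geometric_harmonic[OF that]]] by simp
  then show ?case
    by (intro exI[of _ "\<lambda>n. 1 / real (n + 1)"] exI[of _ 1]) simp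
next
  case (Suc m)
  define w where "w = (\<lambda>m n. (harm n + C) ^ m / real (n + 1))"
  have hC: "harm k + C \<ge> 1" for k using harm_nonneg[of k, where 'a = real] C by linarith
  have w_pos: "w m n > 0" for m n unfolding w_def using hC[of n] by simp
  from Suc.IH obtain a l u where lu: "l > 0" "u > 0"
    and bounds: "\<And>n. l * w m n \<le> a n" "\<And>n. a n \<le> u * w m n"
    and sums: "\<And>x::complex. norm x < 1 \<Longrightarrow>
       (\<lambda>n. of_real (a n) * x ^ n) sums (\<Sum>n. x ^ n / of_nat (n + 1)) ^ (Suc m)"
    unfolding w_def by blast
  have a_pos: "a n > 0" for n
    using bounds(1)[of n] lu(1) w_pos[of m n] by (smt (verit) mult_pos_pos)
  define a' where "a' n = (\<Sum>k\<le>n. a k * (1 / real (n - k + 1)))" for n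
  define l' where "l' = l / (2 ^ (m + 1) * (C + 1))"
  have low: "l' * w (Suc m) n \<le> a' n" for n
  proof -
    have "l' * w (Suc m) n \<le> l' * (2 ^ (m + 1) * (C + 1) * (\<Sum>k\<le>n. w m k * (1 / real (n - k + 1))))"
      unfolding w_def l'_def using lu C
      by (intro mult_left_mono dirichlet_power_conv_bounds(2)[OF C]) auto
    also have "\<dots> = (\<Sum>k\<le>n. l * w m k * (1 / real (n - k + 1)))"
      using C by (simp add: l'_def sum_distrib_left mult.assoc)
    also have "\<dots> \<le> a' n"
      unfolding a'_def by (intro sum_mono mult_right_mono bounds) auto
    finally show ?thesis .
  qed
  have up: "a' n \<le> (u * 2) * w (Suc m) n" for n
  proof -
    have "a' n \<le> (\<Sum>k\<le>n. u * w m k * (1 / real (n - k + 1)))"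
      unfolding a'_def by (intro sum_mono mult_right_mono bounds) auto
    also have "\<dots> = u * (\<Sum>k\<le>n. w m k * (1 / real (n - k + 1)))"
      by (simp add: sum_distrib_left mult.assoc)
    also have "\<dots> \<le> u * (2 * w (Suc m) n)"
      unfolding w_def using lu by (intro mult_left_mono dirichlet_power_conv_bounds(1)[OF C]) auto
    finally show ?thesis by simp
  qed
  have sums': "(\<lambda>n. of_real (a' n) * x ^ n) sums (\<Sum>n. x ^ n / of_nat (n + 1)) ^ Suc (Suc m)"
    if x: "norm x < 1" for x :: complex
  proof -
    \<comment> \<open>The Cauchy product needs absolute convergence; since \<open>a\<close> is
      positive, this is convergence at the real point \<open>norm x\<close>.\<close>
    have "summable (\<lambda>n. of_real (a n) * (of_real (norm x) :: complex) ^ n)"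
      using sums[of "of_real (norm x)"] x by (auto simp: sums_iff)
    then have "summable (\<lambda>n. of_real (a n * norm x ^ n) :: complex)" by simp
    then have "summable (\<lambda>n. a n * norm x ^ n)"
      by (subst (asm) summable_of_real_iff)
    then have "summable (\<lambda>n. norm (of_real (a n) * x ^ n))"
      using a_pos by (simp add: norm_mult norm_power abs_of_pos)
    from Cauchy_product_sums[OF this summable_geometric_harmonic[OF x]]
    have "(\<lambda>n. \<Sum>k\<le>n. (of_real (a k) * x ^ k) * (x ^ (n - k) / of_nat (n - k + 1)))
       sums ((\<Sum>n. x ^ n / of_nat (n + 1)) ^ Suc m * (\<Sum>n. x ^ n / of_nat (n + 1)))"
      using sums[OF x] by (simp add: sums_iff)
    also have "(\<lambda>n. \<Sum>k\<le>n. (of_real (a k) * x ^ k) * (x ^ (n - k) / of_nat (n - k + 1)))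
        = (\<lambda>n. of_real (a' n) * x ^ n)"
    proof (rule ext)
      fix n
      have "(of_real (a k) * x ^ k) * (x ^ (n - k) / of_nat (n - k + 1))
          = of_real (a k * (1 / real (n - k + 1))) * x ^ n" if "k \<le> n" for k
        using power_add[of x k "n - k"] that by simp
      then show "(\<Sum>k\<le>n. (of_real (a k) * x ^ k) * (x ^ (n - k) / of_nat (n - k + 1)))
        = of_real (a' n) * x ^ n"
        unfolding a'_def of_real_sum sum_distrib_right by (intro sum.cong) auto
    qed
    finally show ?thesis by (simp add: mult.commute)
  qed
  have l': "l' > 0" using lu C by (simp add: l'_def)
  show ?case
    by (rule exI[of _ a'], rule exI[of _ l'], rule exI[of _ "u * 2"])
      (use low up sums' l' lu in \<open>unfold w_def, blast intro: mult_pos_pos zero_less_numeral\<close>)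
qed

subsection \<open>Hilbert function spaces\<close>

definition taylor_coeff :: "(complex \<Rightarrow> complex) \<Rightarrow> nat \<Rightarrow> complex"
  where "taylor_coeff f n = (deriv ^^ n) f 0 / fact n"

lemma taylor_coeff_sums:
  assumes "f holomorphic_on \<D>" "z \<in> \<D>"
  shows "(\<lambda>n. taylor_coeff f n * z ^ n) sums f z"
  using holomorphic_power_series[OF assms] by (simp add: taylor_coeff_def)

lemma taylor_coeff_unique:
  assumes "\<And>z. z \<in> \<D> \<Longrightarrow> (\<lambda>n. p n * z ^ n) sums f z"
  shows "taylor_coeff f = p"
proof -
  have "eventually (\<lambda>z. z \<in> \<D>) (nhds (0::complex))"
    by (intro eventually_nhds_in_open) auto
  then have "eventually (\<lambda>u. (\<lambda>n. fps_nth (Abs_fps p) n * u ^ n) sums f u) (nhds 0)"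
    by eventually_elim (use assms in simp)
  then have "f has_fps_expansion Abs_fps p" by (rule has_fps_expansionI)
  from fps_nth_fps_expansion[OF this] show ?thesis
    by (auto simp: taylor_coeff_def)
qed

section \<open>Inner product geometry and a convergence criterion\<close>

context hilbert_function_space
begin

lemma diff_closed: "f \<in> H \<Longrightarrow> g \<in> H \<Longrightarrow> (\<lambda>x. f x - g x) \<in> H"
  using add_closed[of f "\<lambda>x. (-1) * g x"] scale_closed[of g "-1"] by simp

text \<open>Membership is asked only below \<open>n\<close>, because the induction on monomials
  knows only the lower degrees.\<close>

lemma sum_closed: "(\<And>k. k < (n::nat) \<Longrightarrow> f k \<in> H) \<Longrightarrow> (\<lambda>x. \<Sum>k<n. c k * f k x) \<in> H"
proof (induction n)
  case (Suc n)
  then show ?case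
    using add_closed[of "\<lambda>x. \<Sum>k<n. c k * f k x" "\<lambda>x. c n * f n x"] scale_closed[of "f n" "c n"] by simp
qed (simp add: zero_closed)

lemma ip_add_right: "f \<in> H \<Longrightarrow> g \<in> H \<Longrightarrow> h \<in> H \<Longrightarrow> ip f (\<lambda>x. g x + h x) = ip f g + ip f h"
  using ip_cnj[of "\<lambda>x. g x + h x" f] ip_cnj[of g f] ip_cnj[of h f] by (simp add: add_closed ip_add)

lemma ip_scale_right: "f \<in> H \<Longrightarrow> g \<in> H \<Longrightarrow> ip f (\<lambda>x. c * g x) = cnj c * ip f g"
  using ip_cnj[of "\<lambda>x. c * g x" f] ip_cnj[of g f] by (simp add: scale_closed ip_scale)

lemma ip_diff: "f \<in> H \<Longrightarrow> g \<in> H \<Longrightarrow> h \<in> H \<Longrightarrow> ip (\<lambda>x. f x - g x) h = ip f h - ip g h"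
  using ip_add[of f "\<lambda>x. (-1) * g x" h] ip_scale[of g h "-1"] scale_closed[of g "-1"] by simp

lemma ip_diff_right: "f \<in> H \<Longrightarrow> g \<in> H \<Longrightarrow> h \<in> H \<Longrightarrow> ip f (\<lambda>x. g x - h x) = ip f g - ip f h"
  using ip_add_right[of f g "\<lambda>x. (-1) * h x"] ip_scale_right[of f h "-1"] scale_closed[of h "-1"] by simp

lemma ip_sum:
  assumes "\<And>k. k < (n::nat) \<Longrightarrow> f k \<in> H" "g \<in> H"
  shows "ip (\<lambda>x. \<Sum>k<n. c k * f k x) g = (\<Sum>k<n. c k * ip (f k) g)"
  using assms(1)
proof (induction n)
  case 0
  then show ?case using ip_scale[OF assms(2) assms(2), of 0] ip_scale[OF zero_closed assms(2), of 0] by simp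
next
  case (Suc n)
  then show ?case
    using ip_add[of "\<lambda>x. \<Sum>k<n. c k * f k x" "\<lambda>x. c n * f n x" g] sum_closed[where n = n and f = f and c = c]
      scale_closed[of "f n" "c n"] ip_scale[of "f n" g] assms(2) by simp
qed

lemma ip_sum_right:
  assumes "\<And>k. k < (n::nat) \<Longrightarrow> f k \<in> H" "g \<in> H"
  shows "ip g (\<lambda>x. \<Sum>k<n. c k * f k x) = (\<Sum>k<n. cnj (c k) * ip g (f k))"
proof -
  have "ip g (\<lambda>x. \<Sum>k<n. c k * f k x) = cnj (\<Sum>k<n. c k * ip (f k) g)"
    using ip_cnj[OF sum_closed[OF assms(1), where c = c] assms(2)] ip_sum[OF assms, where c = c] by simp
  also have "\<dots> = (\<Sum>k<n. cnj (c k) * ip g (f k))"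
    using ip_cnj[OF assms(1) assms(2)] by simp
  finally show ?thesis .
qed

lemma ip_self: "f \<in> H \<Longrightarrow> ip f f = of_real (ip_norm ip f ^ 2)"
  using ip_nonneg[of f] unfolding ip_norm_def
  by (auto simp: nonneg_Reals_def complex_eq_iff)

lemma ip_norm_nonneg: "f \<in> H \<Longrightarrow> ip_norm ip f \<ge> 0"
  using ip_nonneg[of f] unfolding ip_norm_def by (auto simp: nonneg_Reals_def)

lemma norm_sq: "f \<in> H \<Longrightarrow> ip_norm ip f ^ 2 = Re (ip f f)"
  using ip_self[of f] by simp

lemma norm_diff_sq:
  assumes "f \<in> H" "g \<in> H"
  shows "ip_norm ip (\<lambda>x. f x - g x) ^ 2 = ip_norm ip f ^ 2 - 2 * Re (ip f g) + ip_norm ip g ^ 2"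
  using assms ip_cnj[of f g] by (simp add: norm_sq diff_closed ip_diff ip_diff_right)

lemma Cauchy_Schwarz:
  assumes "f \<in> H" "g \<in> H"
  shows "norm (ip f g) \<le> ip_norm ip f * ip_norm ip g"
proof (cases "ip g g = 0")
  case True
  then have "g = (\<lambda>x. 0 * g x)" using ip_definite[OF assms(2)] by simp
  then have "ip f g = 0" using ip_scale_right[OF assms, of 0] by simp
  then show ?thesis using assms ip_norm_nonneg by simp
next
  case False
  define G where "G = ip_norm ip g ^ 2"
  have G: "G > 0" using False assms by (simp add: G_def ip_self)
  define c where "c = ip f g / of_real G"
  have "0 \<le> ip_norm ip (\<lambda>x. f x - c * g x) ^ 2" by simp
  also have "\<dots> = ip_norm ip f ^ 2 - 2 * Re (cnj c * ip f g) + Re (ip (\<lambda>x. c * g x) (\<lambda>x. c * g x))"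
    using assms by (simp add: norm_diff_sq scale_closed ip_scale_right norm_sq[of "\<lambda>x. c * g x"])
  also have "ip (\<lambda>x. c * g x) (\<lambda>x. c * g x) = of_real (norm c ^ 2 * G)"
    using assms by (simp add: scale_closed ip_scale_right ip_scale ip_self G_def complex_norm_square[symmetric] mult.assoc[symmetric] mult.commute[of "cnj c"] del: of_real_power)
  also have "cnj c * ip f g = of_real (norm (ip f g) ^ 2 / G)"
    unfolding c_def of_real_divide complex_norm_square by simp
  also have "norm c ^ 2 * G = norm (ip f g) ^ 2 / G"
    using G by (simp add: c_def norm_divide power_divide power2_eq_square)
  finally have "norm (ip f g) ^ 2 \<le> (ip_norm ip f * ip_norm ip g) ^ 2"
    using G by (simp add: field_simps G_def power_mult_distrib)
  then show ?thesis
    by (rule power2_le_imp_le) (use assms ip_norm_nonneg in simp)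
qed

lemma ip_tendsto:
  assumes "\<And>n. u n \<in> H" "f \<in> H" "g \<in> H"
    and "(\<lambda>n. ip_norm ip (\<lambda>x. u n x - f x)) \<longlonglongrightarrow> 0"
  shows "(\<lambda>n. ip (u n) g) \<longlonglongrightarrow> ip f g" "(\<lambda>n. ip g (u n)) \<longlonglongrightarrow> ip g f"
proof -
  have "(\<lambda>n. ip (u n) g - ip f g) \<longlonglongrightarrow> 0"
  proof (rule Lim_null_comparison)
    show "\<forall>\<^sub>F n in sequentially. norm (ip (u n) g - ip f g) \<le> ip_norm ip (\<lambda>x. u n x - f x) * ip_norm ip g"
      using Cauchy_Schwarz[of "\<lambda>x. u _ x - f x" g] assms by (simp add: diff_closed ip_diff)
    show "(\<lambda>n. ip_norm ip (\<lambda>x. u n x - f x) * ip_norm ip g) \<longlonglongrightarrow> 0"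
      using tendsto_mult_left_zero[OF assms(4)] by simp
  qed
  then show *: "(\<lambda>n. ip (u n) g) \<longlonglongrightarrow> ip f g" using LIM_zero_iff by blast
  from tendsto_cnj[OF this] show "(\<lambda>n. ip g (u n)) \<longlonglongrightarrow> ip g f"
    using assms by (simp add: ip_cnj[symmetric])
qed

text \<open>In the expansion of the squared distance of \<open>u m\<close> and \<open>u n\<close>
  the limits cancel as \<open>l - 2 * l + l\<close>. No candidate for the limit is required, only
  the inner products, which can be computed explicitly in both applications.\<close>

lemma converges_if_Gram_converges:
  assumes u: "\<And>n. u n \<in> H"
    and gram: "\<And>e. e > 0 \<Longrightarrow> \<exists>N. \<forall>m\<ge>N. \<forall>n\<ge>N. norm (ip (u m) (u n) - l) < e"
  shows "\<exists>f\<in>H. (\<lambda>n. ip_norm ip (\<lambda>x. u n x - f x)) \<longlonglongrightarrow> 0"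
proof (rule complete[OF u])
  fix e :: real assume e: "e > 0"
    \<comment> \<open>The three Gram entries enter with weights 1, 2, 1, so errors of
      \<open>e ^ 2 / 4\<close> add up to \<open>e ^ 2\<close>.\<close>
    obtain N where N: "\<And>m n. m \<ge> N \<Longrightarrow> n \<ge> N \<Longrightarrow> norm (ip (u m) (u n) - l) < e ^ 2 / 4"
      using gram[of "e ^ 2 / 4"] e by auto
    have "ip_norm ip (\<lambda>x. u m x - u n x) < e" if "m \<ge> N" "n \<ge> N" for m n
    proof (rule power2_less_imp_less)
      have R: "\<bar>Re (ip (u i) (u j)) - Re l\<bar> < e ^ 2 / 4" if "i \<ge> N" "j \<ge> N" for i j
        using abs_Re_le_cmod[of "ip (u i) (u j) - l"] N[OF that] by simp
      have "ip_norm ip (\<lambda>x. u m x - u n x) ^ 2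
          = Re (ip (u m) (u m)) - 2 * Re (ip (u m) (u n)) + Re (ip (u n) (u n))"
        using u by (simp add: norm_diff_sq norm_sq)
      also have "\<dots> < e ^ 2" using R[of m m] R[of m n] R[of n n] that by linarith
      finally show "ip_norm ip (\<lambda>x. u m x - u n x) ^ 2 < e ^ 2" .
    qed (use e in simp)
    then show "\<exists>N. \<forall>m\<ge>N. \<forall>n\<ge>N. ip_norm ip (\<lambda>x. u m x - u n x) < e" by blast
qed

end

subsection \<open>Spaces with diagonal kernel\<close>

lemma power_series_tail_sums:
  fixes c :: "nat \<Rightarrow> complex" and t :: real
  assumes "(\<lambda>k. c k * of_real t ^ k) sums s" "t > 0"
  shows "(\<lambda>k. c (k + n) * of_real t ^ k) sums (of_real (1 / t ^ n) * (s - (\<Sum>k<n. c k * of_real t ^ k)))"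
proof -
  have "(\<lambda>k. of_real (1 / t ^ n) * (c (k + n) * of_real t ^ (k + n)))
      sums (of_real (1 / t ^ n) * (s - (\<Sum>k<n. c k * of_real t ^ k)))"
    by (intro sums_mult sums_split_initial_segment assms(1))
  then show ?thesis using assms(2) by (simp add: power_add)
qed

text \<open>Convergence at one nonzero point gives a positive radius of convergence;
  \<open>1 / 2\<close> is merely a convenient point of the disc.\<close>

lemma power_series_tail_isCont:
  fixes c :: "nat \<Rightarrow> complex"
  assumes "summable (\<lambda>k. c k * of_real (1 / 2) ^ k)"
  shows "isCont (\<lambda>x. \<Sum>k. c (k + n) * x ^ k) 0"
proof (rule isCont_powser)
  show "summable (\<lambda>k. c (k + n) * of_real (1 / 2) ^ k)"
    by (rule sums_summable[OF power_series_tail_sums[OF summable_sums[OF assms]]]) simp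
qed simp

lemma taylor_coeff_add:
  assumes "f holomorphic_on \<D>" "g holomorphic_on \<D>"
  shows "taylor_coeff (\<lambda>z. f z + g z) n = taylor_coeff f n + taylor_coeff g n"
proof -
  have "taylor_coeff (\<lambda>z. f z + g z) = (\<lambda>n. taylor_coeff f n + taylor_coeff g n)"
  proof (rule taylor_coeff_unique)
    fix z :: complex assume "z \<in> \<D>"
    from sums_add[OF taylor_coeff_sums[OF assms(1) this] taylor_coeff_sums[OF assms(2) this]]
    show "(\<lambda>n. (taylor_coeff f n + taylor_coeff g n) * z ^ n) sums (f z + g z)"
      by (simp add: distrib_right)
  qed
  then show ?thesis by simp
qed

lemma taylor_coeff_scale:
  assumes "f holomorphic_on \<D>"
  shows "taylor_coeff (\<lambda>z. c * f z) n = c * taylor_coeff f n"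
proof -
  have "taylor_coeff (\<lambda>z. c * f z) = (\<lambda>n. c * taylor_coeff f n)"
  proof (rule taylor_coeff_unique)
    fix z :: complex assume "z \<in> \<D>"
    from sums_mult[OF taylor_coeff_sums[OF assms this], of c]
    show "(\<lambda>n. c * taylor_coeff f n * z ^ n) sums (c * f z)" by (simp add: mult.assoc)
  qed
  then show ?thesis by simp
qed

lemma mult_cnj_in_disc: "z \<in> \<D> \<Longrightarrow> w \<in> \<D> \<Longrightarrow> norm (cnj z * w) < 1"
  using mult_strict_mono[of "norm z" 1 "norm w" 1] by (auto simp: norm_mult)

definition diagonal_kernel :: "(nat \<Rightarrow> real) \<Rightarrow> complex \<Rightarrow> complex \<Rightarrow> complex"
  where "diagonal_kernel p w z = (\<Sum>n. of_real (p n) * (cnj z * w) ^ n)"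

lemma summable_norm_powser:
  fixes p :: "nat \<Rightarrow> real" and x :: complex
  assumes "\<And>n. 0 \<le> p n" "\<And>r. 0 \<le> r \<Longrightarrow> r < 1 \<Longrightarrow> summable (\<lambda>n. p n * r ^ n)" "norm x < 1"
  shows "summable (\<lambda>n. norm (of_real (p n) * x ^ n))"
  using assms(2)[of "norm x"] assms(1,3) by (simp add: norm_mult norm_power)

lemma diagonal_kernel_sums:
  assumes "\<And>n. 0 \<le> p n" "\<And>r. 0 \<le> r \<Longrightarrow> r < 1 \<Longrightarrow> summable (\<lambda>n. p n * r ^ n)"
    and "z \<in> \<D>" "w \<in> \<D>"
  shows "(\<lambda>n. of_real (p n) * (cnj z * w) ^ n) sums diagonal_kernel p w z"
  unfolding diagonal_kernel_def
  by (rule summable_sums[OF summable_norm_cancel[OF summable_norm_powser]])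
    (use assms mult_cnj_in_disc in blast)+

definition disc_monomial :: "nat \<Rightarrow> complex \<Rightarrow> complex"
  where "disc_monomial n = (\<lambda>z. if z \<in> \<D> then z ^ n else 0)"

lemma taylor_coeff_sum_monomials:
  "taylor_coeff (\<lambda>z. \<Sum>k<N. p k * disc_monomial k z) = (\<lambda>k. if k < N then p k else 0)"
proof (rule taylor_coeff_unique)
  fix z :: complex assume "z \<in> \<D>"
  then have "(\<Sum>k<N. p k * disc_monomial k z) = (\<Sum>k<N. (if k < N then p k else 0) * z ^ k)"
    by (simp add: disc_monomial_def)
  then show "(\<lambda>k. (if k < N then p k else 0) * z ^ k) sums (\<Sum>k<N. p k * disc_monomial k z)"
    using sums_finite[of "{..<N}" "\<lambda>k. (if k < N then p k else 0) * z ^ k"] by simp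
qed

locale diagonal_kernel_space = hilbert_function_space \<D> H ip
  for H :: "(complex \<Rightarrow> complex) set" and ip +
  fixes a :: "nat \<Rightarrow> real"
  assumes a_pos: "\<And>n. 0 < a n"
    and a_summable: "\<And>r. 0 \<le> r \<Longrightarrow> r < 1 \<Longrightarrow> summable (\<lambda>n. a n * r ^ n)"
    and holo: "\<And>f. f \<in> H \<Longrightarrow> f holomorphic_on \<D>"
    and reproducing: "reproducing_kernel \<D> H ip (diagonal_kernel a)"
begin

abbreviation kernel_at :: "complex \<Rightarrow> complex \<Rightarrow> complex"
  where "kernel_at z \<equiv> kernel_fun \<D> (diagonal_kernel a) z"

lemma kernel_at: "z \<in> \<D> \<Longrightarrow> kernel_at z \<in> H" "z \<in> \<D> \<Longrightarrow> f \<in> H \<Longrightarrow> ip f (kernel_at z) = f z"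
  using reproducing unfolding reproducing_kernel_def by auto

lemma kernel_at_sums:
  assumes "z \<in> \<D>" "w \<in> \<D>"
  shows "(\<lambda>n. (of_real (a n) * cnj z ^ n) * w ^ n) sums kernel_at z w"
  using diagonal_kernel_sums[of a z w] a_pos a_summable assms
  by (simp add: kernel_fun_def power_mult_distrib mult.assoc less_imp_le)

lemma coeff_sums: "f \<in> H \<Longrightarrow> z \<in> \<D> \<Longrightarrow> (\<lambda>n. taylor_coeff f n * z ^ n) sums f z"
  by (rule taylor_coeff_sums) (auto simp: holo)

lemma eq_if_coeff_eq:
  assumes "f \<in> H" "\<And>x. x \<notin> \<D> \<Longrightarrow> g x = 0"
    "\<And>z. z \<in> \<D> \<Longrightarrow> (\<lambda>n. taylor_coeff f n * z ^ n) sums g z"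
  shows "f = g"
proof
  fix z show "f z = g z"
  proof (cases "z \<in> \<D>")
    case True
    then show ?thesis using sums_unique2[OF coeff_sums[OF assms(1) True] assms(3)[OF True]] by simp
  next
    case False
    then show ?thesis using vanish_outside[OF assms(1) False] assms(2)[OF False] by simp
  qed
qed

text \<open>The monomial of degree \<open>n\<close> is, up to the factor \<open>a n\<close>, the limit as \<open>t \<rightarrow> 0+\<close> of the kernel
  function at \<open>t\<close> minus its Taylor polynomial of degree below \<open>n\<close>, divided by \<open>t ^ n\<close>.\<close>

lemma monomial_in_H:
  "disc_monomial n \<in> H \<and> (\<forall>f\<in>H. ip f (disc_monomial n) = taylor_coeff f n / of_real (a n))"
proof (induction n rule: less_induct)
  case (less n)
  define u where "u t = (\<lambda>z. of_real (1 / t ^ n) *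
      (kernel_at (of_real t) z - (\<Sum>k<n. of_real (a k * t ^ k) * disc_monomial k z)))" for t :: real
  have disc: "complex_of_real t \<in> \<D>" if "0 < t" "t < 1" for t using that by simp
  have sumH: "(\<lambda>z. \<Sum>k<n. of_real (a k * t ^ k) * disc_monomial k z) \<in> H" for t :: real
    by (rule sum_closed) (use less in blast)
  have uH: "u t \<in> H" if t: "0 < t" "t < 1" for t
    unfolding u_def by (intro scale_closed diff_closed kernel_at sumH disc t)
  \<comment> \<open>Pairing with the kernel function evaluates \<open>f\<close> at \<open>t\<close>,
    and the induction hypothesis turns the subtracted monomials into the Taylor polynomial of
    \<open>f\<close>. What remains is the shifted series, whose value at 0 is the coefficient of
    degree \<open>n\<close>.\<close>
  have ip_u: "(\<lambda>k. taylor_coeff f (k + n) * of_real t ^ k) sums ip f (u t)"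
    if t: "0 < t" "t < 1" and f: "f \<in> H" for t f
  proof -
    have "ip f (\<lambda>z. \<Sum>k<n. of_real (a k * t ^ k) * disc_monomial k z)
        = (\<Sum>k<n. cnj (of_real (a k * t ^ k)) * ip f (disc_monomial k))"
      by (rule ip_sum_right) (use less f in blast)+
    also have "\<dots> = (\<Sum>k<n. taylor_coeff f k * of_real t ^ k)"
    proof (intro sum.cong refl)
      fix k assume "k \<in> {..<n}"
      then show "cnj (of_real (a k * t ^ k)) * ip f (disc_monomial k) = taylor_coeff f k * of_real t ^ k"
        using less[of k] f a_pos[of k] by simp
    qed
    finally have "ip f (u t) = of_real (1 / t ^ n) * (f (of_real t) - (\<Sum>k<n. taylor_coeff f k * of_real t ^ k))"
      unfolding u_def ip_scale_right[OF f diff_closed[OF kernel_at(1)[OF disc[OF t]] sumH]]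
        ip_diff_right[OF f kernel_at(1)[OF disc[OF t]] sumH] kernel_at(2)[OF disc[OF t] f]
      by simp
    then show ?thesis
      using power_series_tail_sums[OF coeff_sums[OF f disc[OF t]] t(1)] by simp
  qed
  have coeff_u: "taylor_coeff (u s) = (\<lambda>m. if m < n then 0 else of_real (a m * s ^ (m - n)))"
    if s: "0 < s" "s < 1" for s
  proof (rule taylor_coeff_unique)
    fix z :: complex assume z: "z \<in> \<D>"
    have "(\<lambda>k. (of_real (a (k + n)) * of_real s ^ (k + n)) * z ^ (k + n)) sums
        (kernel_at (of_real s) z - (\<Sum>k<n. (of_real (a k) * of_real s ^ k) * z ^ k))"
      using sums_split_initial_segment[OF kernel_at_sums[OF disc[OF s] z], of n] by simp
    also have "(\<Sum>k<n. (of_real (a k) * of_real s ^ k) * z ^ k)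
        = (\<Sum>k<n. of_real (a k * s ^ k) * disc_monomial k z)"
      using z by (simp add: disc_monomial_def)
    finally have "(\<lambda>k. of_real (1 / s ^ n) * ((of_real (a (k + n)) * of_real s ^ (k + n)) * z ^ (k + n)))
        sums u s z"
      unfolding u_def by (rule sums_mult)
    moreover have "of_real (1 / s ^ n) * ((of_real (a (k + n)) * of_real s ^ (k + n)) * z ^ (k + n))
        = of_real (a (k + n) * s ^ k) * z ^ (k + n)" for k
      using s by (simp add: power_add[of s] power_add[of "complex_of_real s"])
    ultimately have "(\<lambda>k. of_real (a (k + n) * s ^ k) * z ^ (k + n)) sums u s z"
      by (simp only:)
    then have "(\<lambda>k. (if k + n < n then 0 else of_real (a (k + n) * s ^ (k + n - n))) * z ^ (k + n))
       sums (u s z - (\<Sum>k<n. (if k < n then 0 else of_real (a k * s ^ (k - n))) * z ^ k))"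
      by simp
    then show "(\<lambda>m. (if m < n then 0 else of_real (a m * s ^ (m - n))) * z ^ m) sums u s z"
      by (subst (asm) sums_iff_shift) simp
  qed
  \<comment> \<open>The Gram entries of the \<open>u s\<close> depend only on the product of the
    parameters, through \<open>A\<close>; continuity at 0 makes them converge.\<close>
  define A where "A x = (\<Sum>k. of_real (a (k + n)) * x ^ k)" for x :: complex
  have "summable (\<lambda>k. of_real (a k * (1 / 2) ^ k) :: complex)"
    by (subst summable_of_real_iff) (rule a_summable, auto)
  then have contA: "isCont A 0"
    unfolding A_def by (intro power_series_tail_isCont) simp
  have gram: "ip (u s) (u t) = A (of_real (s * t))" if st: "0 < s" "s < 1" "0 < t" "t < 1" for s t
    using sums_unique[OF ip_u[OF st(3,4) uH[OF st(1,2)]]]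
    by (simp add: coeff_u[OF st(1,2)] A_def power_mult_distrib mult.assoc)
  \<comment> \<open>Any null sequence in the open unit interval would do; adding 2 keeps
    \<open>s 0\<close> below 1.\<close>
  define s where "s j = 1 / (real j + 2)" for j
  have s: "0 < s j" "s j < 1" for j by (auto simp: s_def field_simps)
  have s_lim: "s \<longlonglongrightarrow> 0"
    unfolding s_def by real_asymp
  have "\<exists>h\<in>H. (\<lambda>j. ip_norm ip (\<lambda>x. u (s j) x - h x)) \<longlonglongrightarrow> 0"
  proof (rule converges_if_Gram_converges[where l = "A 0"])
    fix e :: real assume "e > 0"
    then obtain d where d: "d > 0" "\<And>x. norm x < d \<Longrightarrow> norm (A x - A 0) < e"
      using contA unfolding continuous_at_eps_delta by (auto simp: dist_norm)
    from order_tendstoD(2)[OF s_lim d(1)] obtain N where N: "\<And>j. j \<ge> N \<Longrightarrow> s j < d"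
      by (auto simp: eventually_sequentially)
    have "norm (ip (u (s i)) (u (s j)) - A 0) < e" if "i \<ge> N" "j \<ge> N" for i j
    proof -
      have "s i * s j \<le> s i" using s[of i] s[of j] by (simp add: mult_le_cancel_left1)
      then have "s i * s j < d" using N[OF that(1)] by linarith
      then have "norm (complex_of_real (s i * s j)) < d"
        using s[of i] s[of j] by (simp add: norm_mult)
      then show ?thesis unfolding gram[OF s s] by (rule d(2))
    qed
    then show "\<exists>N. \<forall>i\<ge>N. \<forall>j\<ge>N. norm (ip (u (s i)) (u (s j)) - A 0) < e" by blast
  qed (use uH s in blast)
  then obtain h where h: "h \<in> H" "(\<lambda>j. ip_norm ip (\<lambda>x. u (s j) x - h x)) \<longlonglongrightarrow> 0" by blast
  have ip_h: "ip f h = taylor_coeff f n" if f: "f \<in> H" for f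
  proof (rule LIMSEQ_unique)
    show "(\<lambda>j. ip f (u (s j))) \<longlonglongrightarrow> ip f h"
      by (rule ip_tendsto(2)[OF _ h(1) f h(2)]) (use uH s in blast)
    have "summable (\<lambda>k. taylor_coeff f k * of_real (1 / 2) ^ k)"
      by (rule sums_summable[OF coeff_sums[OF f disc]]) auto
    then have "isCont (\<lambda>x. \<Sum>k. taylor_coeff f (k + n) * x ^ k) 0"
      by (rule power_series_tail_isCont)
    moreover have "(\<lambda>j. complex_of_real (s j)) \<longlonglongrightarrow> 0"
      using tendsto_of_real[OF s_lim] by simp
    ultimately have "(\<lambda>j. \<Sum>k. taylor_coeff f (k + n) * of_real (s j) ^ k)
        \<longlonglongrightarrow> (\<Sum>k. taylor_coeff f (k + n) * 0 ^ k)"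
      by (rule isCont_tendsto_compose)
    moreover have "(\<Sum>k. taylor_coeff f (k + n) * of_real (s j) ^ k) = ip f (u (s j))" for j
      using sums_unique[OF ip_u[OF s f]] by simp
    ultimately show "(\<lambda>j. ip f (u (s j))) \<longlonglongrightarrow> taylor_coeff f n" by simp
  qed
  \<comment> \<open>The limit is identified by testing it against kernel functions:
    \<open>ip_h\<close> gives the value of the pairing and the reproducing property reads it as
    \<open>h z\<close>.\<close>
  have h_eq: "h z = of_real (a n) * disc_monomial n z" for z
  proof (cases "z \<in> \<D>")
    case True
    have "taylor_coeff (kernel_at z) = (\<lambda>n. of_real (a n) * cnj z ^ n)"
      by (rule taylor_coeff_unique) (rule kernel_at_sums[OF True])
    then have "ip (kernel_at z) h = of_real (a n) * cnj z ^ n"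
      using ip_h[OF kernel_at(1)[OF True]] by simp
    then have "ip h (kernel_at z) = of_real (a n) * z ^ n"
      using ip_cnj[OF kernel_at(1)[OF True] h(1)] by simp
    then show ?thesis using kernel_at(2)[OF True h(1)] True by (simp add: disc_monomial_def)
  next
    case False
    then show ?thesis using vanish_outside[OF h(1) False] by (simp add: disc_monomial_def)
  qed
  have e_eq: "disc_monomial n = (\<lambda>z. of_real (1 / a n) * h z)"
    using a_pos[of n] by (auto simp: h_eq)
  show ?case
    unfolding e_eq
  proof (intro conjI ballI)
    show "(\<lambda>z. of_real (1 / a n) * h z) \<in> H" by (rule scale_closed[OF h(1)])
    show "ip f (\<lambda>z. of_real (1 / a n) * h z) = taylor_coeff f n / of_real (a n)" if "f \<in> H" for f
      unfolding ip_scale_right[OF that h(1)] ip_h[OF that] by simp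
  qed
qed

section \<open>The norm as a weighted square sum of Taylor coefficients\<close>

abbreviation partial_sum :: "(nat \<Rightarrow> complex) \<Rightarrow> nat \<Rightarrow> complex \<Rightarrow> complex"
  where "partial_sum p N \<equiv> (\<lambda>z. \<Sum>k<N. p k * disc_monomial k z)"

lemma partial_sum_closed: "partial_sum p N \<in> H"
  by (rule sum_closed) (use monomial_in_H in blast)

lemma ip_partial_sum:
  assumes "f \<in> H"
  shows "ip f (partial_sum p N) = (\<Sum>k<N. cnj (p k) * taylor_coeff f k / of_real (a k))"
proof -
  have "ip f (partial_sum p N) = (\<Sum>k<N. cnj (p k) * ip f (disc_monomial k))"
    by (rule ip_sum_right) (use monomial_in_H assms in blast)+
  then show ?thesis using monomial_in_H assms by simp
qed

text \<open>The monomials are orthogonal with squared norms \<open>1 / a k\<close>, so only common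
  indices survive. Hence the Gram entries converge as soon as the weighted square sum does.\<close>

lemma ip_partial_sums:
  "ip (partial_sum p M) (partial_sum p N) = of_real (\<Sum>k<min M N. norm (p k) ^ 2 / a k)"
proof -
  have "ip (partial_sum p M) (partial_sum p N)
      = (\<Sum>k<N. if k < M then cnj (p k) * p k / of_real (a k) else 0)"
    unfolding ip_partial_sum[OF partial_sum_closed] taylor_coeff_sum_monomials
    by (intro sum.cong) auto
  also have "\<dots> = (\<Sum>k<min M N. cnj (p k) * p k / of_real (a k))"
    by (intro sum.mono_neutral_cong_right) auto
  also have "\<dots> = (\<Sum>k<min M N. of_real (norm (p k) ^ 2 / a k))"
    unfolding of_real_divide complex_norm_square by (simp add: mult.commute)
  finally show ?thesis by simp
qed

text \<open>A Riesz-Fischer argument: the partial sums converge by the Gram criterion, and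
  continuity of the inner product transfers coefficients and norm to the limit.\<close>

lemma ex_if_summable_coeffs:
  assumes "summable (\<lambda>k. norm (p k) ^ 2 / a k)"
  shows "\<exists>g\<in>H. taylor_coeff g = p \<and> ip_norm ip g ^ 2 = (\<Sum>k. norm (p k) ^ 2 / a k)"
proof -
  let ?q = "\<lambda>k. norm (p k) ^ 2 / a k"
  have lim: "(\<lambda>n. complex_of_real (sum ?q {..<n})) \<longlonglongrightarrow> of_real (suminf ?q)"
    using summable_LIMSEQ[OF assms] by (rule tendsto_of_real)
  have "\<exists>g\<in>H. (\<lambda>n. ip_norm ip (\<lambda>x. partial_sum p n x - g x)) \<longlonglongrightarrow> 0"
  proof (rule converges_if_Gram_converges[where l = "of_real (suminf ?q)"])
    fix e :: real assume "e > 0"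
    then obtain N where "\<And>n. n \<ge> N \<Longrightarrow> norm (complex_of_real (sum ?q {..<n}) - of_real (suminf ?q)) < e"
      using LIMSEQ_D[OF lim] by blast
    then have "norm (ip (partial_sum p m) (partial_sum p n) - of_real (suminf ?q)) < e"
      if "m \<ge> N" "n \<ge> N" for m n
      unfolding ip_partial_sums using that by simp
    then show "\<exists>N. \<forall>m\<ge>N. \<forall>n\<ge>N. norm (ip (partial_sum p m) (partial_sum p n) - of_real (suminf ?q)) < e"
      by blast
  qed (rule partial_sum_closed)
  then obtain g where g: "g \<in> H" "(\<lambda>n. ip_norm ip (\<lambda>x. partial_sum p n x - g x)) \<longlonglongrightarrow> 0" by blast
  note lims = ip_tendsto[OF partial_sum_closed g(1) _ g(2)]
  have coeff: "taylor_coeff g k = p k" for k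
  proof -
    have e: "disc_monomial k \<in> H" using monomial_in_H by blast
    have "\<forall>\<^sub>F n in sequentially. ip (partial_sum p n) (disc_monomial k) = p k / of_real (a k)"
      using eventually_gt_at_top[of k]
      by eventually_elim (use monomial_in_H partial_sum_closed in \<open>simp add: taylor_coeff_sum_monomials\<close>)
    then have "(\<lambda>n. ip (partial_sum p n) (disc_monomial k)) \<longlonglongrightarrow> p k / of_real (a k)"
      by (rule tendsto_eventually)
    from LIMSEQ_unique[OF this lims(1)[OF e]]
    have "p k / of_real (a k) = taylor_coeff g k / of_real (a k)" using monomial_in_H g(1) by simp
    then show ?thesis using a_pos[of k] by simp
  qed
  have "ip g (partial_sum p n) = of_real (sum ?q {..<n})" for n
    unfolding ip_partial_sum[OF g(1)] coeff of_real_sum of_real_divide complex_norm_square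
    by (simp add: mult.commute)
  then have "ip g g = of_real (suminf ?q)"
    using LIMSEQ_unique[OF lims(2)[OF g(1)]] lim by simp
  then have "ip_norm ip g ^ 2 = suminf ?q" using norm_sq[OF g(1)] by simp
  moreover have "taylor_coeff g = p" by (rule ext) (rule coeff)
  ultimately show ?thesis by (intro bexI[OF _ g(1)] conjI)
qed

lemma Bessel_coeffs:
  assumes f: "f \<in> H"
  shows "(\<Sum>k<N. norm (taylor_coeff f k) ^ 2 / a k) \<le> ip_norm ip f ^ 2"
proof -
  define q where "q = (\<Sum>k<N. norm (taylor_coeff f k) ^ 2 / a k)"
  define P where "P = partial_sum (taylor_coeff f) N"
  have P: "P \<in> H" unfolding P_def by (rule partial_sum_closed)
  have "ip f P = of_real q"
    unfolding P_def q_def ip_partial_sum[OF f] of_real_sum of_real_divide complex_norm_square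
    by (simp add: mult.commute)
  moreover have "ip P P = of_real q"
    unfolding P_def q_def ip_partial_sums by simp
  ultimately have "ip_norm ip (\<lambda>x. f x - P x) ^ 2 = ip_norm ip f ^ 2 - q"
    using norm_diff_sq[OF f P] norm_sq[OF P] by simp
  then show ?thesis
    using zero_le_power2[of "ip_norm ip (\<lambda>x. f x - P x)"] by (simp add: q_def)
qed

lemma summable_coeffs:
  assumes f: "f \<in> H"
  shows "summable (\<lambda>k. norm (taylor_coeff f k) ^ 2 / a k)"
proof (rule summableI_nonneg_bounded)
  show "0 \<le> norm (taylor_coeff f n) ^ 2 / a n" for n using a_pos[of n] by simp
  show "(\<Sum>k<n. norm (taylor_coeff f k) ^ 2 / a k) \<le> ip_norm ip f ^ 2" for n
    by (rule Bessel_coeffs[OF f])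
qed

text \<open>Bessel's inequality allows a function \<open>g\<close> with the coefficients of
  \<open>f\<close> and the desired norm to be built; a member of \<open>H\<close> is determined by
  its coefficients, so \<open>g\<close> is \<open>f\<close>. Completeness of the monomial system
  comes out of this uniqueness.\<close>

lemma norm_eq_coeffs:
  assumes f: "f \<in> H"
  shows "ip_norm ip f ^ 2 = (\<Sum>k. norm (taylor_coeff f k) ^ 2 / a k)"
proof -
  obtain g where g: "g \<in> H" "taylor_coeff g = taylor_coeff f"
    "ip_norm ip g ^ 2 = (\<Sum>k. norm (taylor_coeff f k) ^ 2 / a k)"
    using ex_if_summable_coeffs[OF summable_coeffs[OF f]] by blast
  have "f = g"
  proof (rule eq_if_coeff_eq[OF f])
    show "g x = 0" if "x \<notin> \<D>" for x by (rule vanish_outside[OF g(1) that])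
    show "(\<lambda>n. taylor_coeff f n * z ^ n) sums g z" if "z \<in> \<D>" for z
      using coeff_sums[OF g(1) that] unfolding g(2) .
  qed
  then show ?thesis using g by simp
qed

text \<open>Comparable weights define comparable square sums on the same set \<open>H\<close>, so
  definiteness and completeness are inherited from the old norm through the two inequalities
  \<open>le1\<close> and \<open>le2\<close>.\<close>

lemma equivalent_diagonal_norm:
  fixes b :: "nat \<Rightarrow> real"
  assumes lu: "0 < l" "0 < u"
    and b_pos: "\<And>n. 0 < b n"
    and bounds: "\<And>n. l * b n \<le> a n" "\<And>n. a n \<le> u * b n"
  shows "\<exists>ip'. hilbert_function_space \<D> H ip' \<and>
           equivalent_norms H (ip_norm ip) (ip_norm ip') \<and>
           reproducing_kernel \<D> H ip' (diagonal_kernel b)"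
proof -
  let ?c = taylor_coeff
  define ip' where "ip' f g = (\<Sum>k. ?c f k * cnj (?c g k) / of_real (b k))" for f g
  have low: "l * (x / a k) \<le> x / b k" and up: "x / b k \<le> u * (x / a k)" if "x \<ge> 0" for x k
    using mult_right_mono[OF bounds(1)[of k] that] mult_right_mono[OF bounds(2)[of k] that]
      a_pos[of k] b_pos[of k] by (auto simp: field_simps)
  have sq_summable: "summable (\<lambda>k. norm (?c f k) ^ 2 / b k)" if "f \<in> H" for f
  proof (rule summable_comparison_test')
    show "summable (\<lambda>k. u * (norm (?c f k) ^ 2 / a k))"
      by (intro summable_mult summable_coeffs that)
    show "norm (norm (?c f k) ^ 2 / b k) \<le> u * (norm (?c f k) ^ 2 / a k)" for k
      using up[of "norm (?c f k) ^ 2" k] b_pos[of k] by simp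
  qed
  have ip'_summable: "summable (\<lambda>k. ?c f k * cnj (?c g k) / of_real (b k))" if "f \<in> H" "g \<in> H" for f g
  proof (rule summable_comparison_test')
    show "summable (\<lambda>k. norm (?c f k) ^ 2 / b k + norm (?c g k) ^ 2 / b k)"
      by (intro summable_add sq_summable that)
    show "norm (?c f k * cnj (?c g k) / of_real (b k)) \<le> norm (?c f k) ^ 2 / b k + norm (?c g k) ^ 2 / b k" for k
    proof -
      have "2 * (norm (?c f k) * norm (?c g k)) \<le> norm (?c f k) ^ 2 + norm (?c g k) ^ 2"
        using sum_squares_bound[of "norm (?c f k)" "norm (?c g k)"] by simp
      moreover have "0 \<le> norm (?c f k) * norm (?c g k)" by simp
      ultimately have "norm (?c f k) * norm (?c g k) \<le> norm (?c f k) ^ 2 + norm (?c g k) ^ 2" by linarith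
      then show ?thesis
        using b_pos[of k] by (simp add: norm_mult norm_divide add_divide_distrib[symmetric] divide_right_mono)
    qed
  qed
  have ip'_self: "ip' f f = of_real (\<Sum>k. norm (?c f k) ^ 2 / b k)" if f: "f \<in> H" for f
  proof -
    have "ip' f f = (\<Sum>k. of_real (norm (?c f k) ^ 2 / b k))"
      unfolding ip'_def of_real_divide complex_norm_square ..
    also have "\<dots> = of_real (\<Sum>k. norm (?c f k) ^ 2 / b k)"
      by (rule suminf_of_real[OF sq_summable[OF f], symmetric])
    finally show ?thesis .
  qed
  have norm': "ip_norm ip' f = sqrt (\<Sum>k. norm (?c f k) ^ 2 / b k)" if "f \<in> H" for f
    using ip'_self[OF that] by (simp add: ip_norm_def)
  have norm: "ip_norm ip f = sqrt (\<Sum>k. norm (?c f k) ^ 2 / a k)" if "f \<in> H" for f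
    using norm_eq_coeffs[OF that] ip_norm_nonneg[OF that] by (metis real_sqrt_abs abs_of_nonneg)
  have le1: "sqrt l * ip_norm ip f \<le> ip_norm ip' f" if f: "f \<in> H" for f
  proof -
    have "l * (\<Sum>k. norm (?c f k) ^ 2 / a k) \<le> (\<Sum>k. norm (?c f k) ^ 2 / b k)"
      unfolding suminf_mult[OF summable_coeffs[OF f], symmetric]
      by (intro suminf_le low summable_mult summable_coeffs sq_summable f) auto
    then show ?thesis unfolding norm[OF f] norm'[OF f] real_sqrt_mult[symmetric] by simp
  qed
  have le2: "ip_norm ip' f \<le> sqrt u * ip_norm ip f" if f: "f \<in> H" for f
  proof -
    have "(\<Sum>k. norm (?c f k) ^ 2 / b k) \<le> u * (\<Sum>k. norm (?c f k) ^ 2 / a k)"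
      unfolding suminf_mult[OF summable_coeffs[OF f], symmetric]
      by (intro suminf_le up summable_mult summable_coeffs sq_summable f) auto
    then show ?thesis unfolding norm[OF f] norm'[OF f] real_sqrt_mult[symmetric] by simp
  qed
  have equiv: "equivalent_norms H (ip_norm ip) (ip_norm ip')"
    unfolding equivalent_norms_def using le1 le2 lu
    by (intro exI[of _ "sqrt l"] exI[of _ "sqrt u"] conjI) auto
  have "hilbert_function_space \<D> H ip'"
  proof
    fix f g h :: "complex \<Rightarrow> complex" and c :: complex
    show "f \<in> H \<Longrightarrow> x \<notin> \<D> \<Longrightarrow> f x = 0" for x by (rule vanish_outside)
    show "(\<lambda>x. 0) \<in> H" by (rule zero_closed)
    show "f \<in> H \<Longrightarrow> g \<in> H \<Longrightarrow> (\<lambda>x. f x + g x) \<in> H" by (rule add_closed)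
    show "f \<in> H \<Longrightarrow> (\<lambda>x. c * f x) \<in> H" by (rule scale_closed)
    show "ip' (\<lambda>x. f x + g x) h = ip' f h + ip' g h" if "f \<in> H" "g \<in> H" "h \<in> H"
      unfolding ip'_def using suminf_add[OF ip'_summable ip'_summable, of f h g h] that
      by (simp add: taylor_coeff_add holo algebra_simps add_divide_distrib)
    show "ip' (\<lambda>x. c * f x) g = c * ip' f g" if "f \<in> H" "g \<in> H"
      unfolding ip'_def using suminf_mult[OF ip'_summable, of f g c] that
      by (simp add: taylor_coeff_scale holo mult.assoc)
    show "ip' g f = cnj (ip' f g)" if "f \<in> H" "g \<in> H"
      unfolding ip'_def using bounded_linear.suminf[OF bounded_linear_cnj ip'_summable[OF that]]
      by (simp add: mult.commute)
    show "ip' f f \<in> \<real>\<^sub>\<ge>\<^sub>0" if f: "f \<in> H"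
      unfolding ip'_self[OF f] using suminf_nonneg[OF sq_summable[OF f]] b_pos
      by (simp add: less_imp_le)
    show "f = (\<lambda>x. 0)" if f: "f \<in> H" and "ip' f f = 0"
    proof -
      have "ip_norm ip' f = 0" using that by (simp add: ip_norm_def)
      then have "sqrt l * ip_norm ip f \<le> 0" using le1[OF f] by simp
      then have "ip_norm ip f = 0"
        using lu ip_norm_nonneg[OF f] by (simp add: mult_le_0_iff)
      then show ?thesis using ip_definite[OF f] ip_self[OF f] by simp
    qed
  next
    fix v :: "nat \<Rightarrow> complex \<Rightarrow> complex"
    assume v: "\<And>n. v n \<in> H"
      and cauchy: "\<And>e. e > 0 \<Longrightarrow> \<exists>N. \<forall>m\<ge>N. \<forall>n\<ge>N. ip_norm ip' (\<lambda>x. v m x - v n x) < e"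
    \<comment> \<open>The lower comparison makes \<open>v\<close> Cauchy for the old norm; the upper
      one carries the limit back to the new norm.\<close>
    have "\<exists>f\<in>H. (\<lambda>n. ip_norm ip (\<lambda>x. v n x - f x)) \<longlonglongrightarrow> 0"
    proof (rule complete[OF v])
      fix e :: real assume e: "e > 0"
      then obtain N where N: "\<And>m n. m \<ge> N \<Longrightarrow> n \<ge> N \<Longrightarrow> ip_norm ip' (\<lambda>x. v m x - v n x) < sqrt l * e"
        using cauchy[of "sqrt l * e"] lu by auto
      have "ip_norm ip (\<lambda>x. v m x - v n x) < e" if "m \<ge> N" "n \<ge> N" for m n
      proof -
        have "sqrt l * ip_norm ip (\<lambda>x. v m x - v n x) < sqrt l * e"
          using le1[OF diff_closed[OF v v], of m n] N[OF that] by linarith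
        then show ?thesis using lu by simp
      qed
      then show "\<exists>N. \<forall>m\<ge>N. \<forall>n\<ge>N. ip_norm ip (\<lambda>x. v m x - v n x) < e" by blast
    qed
    then obtain f where f: "f \<in> H" "(\<lambda>n. ip_norm ip (\<lambda>x. v n x - f x)) \<longlonglongrightarrow> 0" by blast
    have "(\<lambda>n. ip_norm ip' (\<lambda>x. v n x - f x)) \<longlonglongrightarrow> 0"
    proof (rule tendsto_sandwich[OF _ _ tendsto_const])
      show "\<forall>\<^sub>F n in sequentially. ip_norm ip' (\<lambda>x. v n x - f x) \<le> sqrt u * ip_norm ip (\<lambda>x. v n x - f x)"
        using le2[OF diff_closed[OF v f(1)]] by simp
      show "\<forall>\<^sub>F n in sequentially. 0 \<le> ip_norm ip' (\<lambda>x. v n x - f x)"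
      proof (rule always_eventually, rule allI)
        fix n
        have "0 \<le> sqrt l * ip_norm ip (\<lambda>x. v n x - f x)"
          using lu ip_norm_nonneg[OF diff_closed[OF v f(1)]] by simp
        also have "\<dots> \<le> ip_norm ip' (\<lambda>x. v n x - f x)" by (rule le1[OF diff_closed[OF v f(1)]])
        finally show "0 \<le> ip_norm ip' (\<lambda>x. v n x - f x)" .
      qed
      show "(\<lambda>n. sqrt u * ip_norm ip (\<lambda>x. v n x - f x)) \<longlonglongrightarrow> 0"
        using tendsto_mult_right_zero[OF f(2)] .
    qed
    then show "\<exists>f\<in>H. (\<lambda>n. ip_norm ip' (\<lambda>x. v n x - f x)) \<longlonglongrightarrow> 0" using f(1) by blast
  qed
  moreover have "reproducing_kernel \<D> H ip' (diagonal_kernel b)"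
    unfolding reproducing_kernel_def
  proof
    fix y :: complex assume y: "y \<in> \<D>"
    let ?K = "kernel_fun \<D> (diagonal_kernel b) y"
    define p where "p n = of_real (b n) * cnj y ^ n" for n
    have b_summable: "summable (\<lambda>n. b n * r ^ n)" if "0 \<le> r" "r < 1" for r
    proof (rule summable_comparison_test')
      show "summable (\<lambda>n. 1 / l * (a n * r ^ n))" by (intro summable_mult a_summable that)
      show "norm (b n * r ^ n) \<le> 1 / l * (a n * r ^ n)" for n
      proof -
        have "b n \<le> 1 / l * a n" using bounds(1)[of n] lu by (simp add: field_simps)
        from mult_right_mono[OF this, of "r ^ n"] show ?thesis
          using that b_pos[of n] by (simp add: mult.assoc)
      qed
    qed
    \<comment> \<open>Membership of the new kernel function in \<open>H\<close> is decided with the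
      old weights \<open>a\<close>: one factor \<open>b n / a n\<close> is at most
      \<open>1 / l\<close>, and the rest is the new kernel's series at
      \<open>norm y ^ 2\<close>.\<close>
    have "summable (\<lambda>n. norm (p n) ^ 2 / a n)"
    proof (rule summable_comparison_test')
      have "norm y ^ 2 < 1" using y by (simp add: power_less_one_iff abs_square_less_1)
      then show "summable (\<lambda>n. 1 / l * (b n * (norm y ^ 2) ^ n))"
        by (intro summable_mult b_summable) auto
      show "norm (norm (p n) ^ 2 / a n) \<le> 1 / l * (b n * (norm y ^ 2) ^ n)" for n
      proof -
        have "b n / a n \<le> 1 / l" using bounds(1)[of n] lu a_pos[of n] by (simp add: field_simps)
        then have "b n / a n * (b n * (norm y ^ 2) ^ n) \<le> 1 / l * (b n * (norm y ^ 2) ^ n)"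
          using b_pos[of n] by (intro mult_right_mono) auto
        moreover have "norm (norm (p n) ^ 2 / a n) = b n / a n * (b n * (norm y ^ 2) ^ n)"
          using a_pos[of n] b_pos[of n]
          by (simp add: p_def norm_mult norm_power power_mult_distrib power2_eq_square)
        ultimately show ?thesis by simp
      qed
    qed
    from ex_if_summable_coeffs[OF this] obtain g where g: "g \<in> H" "?c g = p" by blast
    have K_sums: "(\<lambda>n. p n * z ^ n) sums ?K z" if "z \<in> \<D>" for z
      using diagonal_kernel_sums[of b y z] b_pos b_summable y that
      by (simp add: kernel_fun_def p_def power_mult_distrib mult.assoc less_imp_le)
    have "g = ?K"
      by (rule eq_if_coeff_eq[OF g(1)]) (use g(2) K_sums in \<open>auto simp: kernel_fun_def\<close>)
    then have K: "?K \<in> H" "?c ?K = p" using g by auto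
    have "f y = ip' f ?K" if f: "f \<in> H" for f
    proof -
      have "ip' f ?K = (\<Sum>k. ?c f k * y ^ k)"
        unfolding ip'_def K(2) p_def using b_pos by (simp add: less_imp_neq[symmetric])
      then show ?thesis using sums_unique[OF coeff_sums[OF f y]] by simp
    qed
    then show "?K \<in> H \<and> (\<forall>f\<in>H. f y = ip' f ?K)" using K(1) by blast
  qed
  ultimately show ?thesis using equiv by blast
qed

end

subsection \<open>The complete Pick property of diagonal kernels\<close>

text \<open>Each term of the series is a nonnegative multiple of a rank-one kernel, so the quadratic
  form is a series of weighted squared moduli.\<close>

lemma pos_semidef_diagonal_kernel:
  assumes p: "\<And>n. 0 \<le> p n" "\<And>r. 0 \<le> r \<Longrightarrow> r < 1 \<Longrightarrow> summable (\<lambda>n. p n * r ^ n)"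
  shows "pos_semidef \<D> (diagonal_kernel p)"
  unfolding pos_semidef_def
proof (intro allI impI)
  fix S :: "complex set" and c :: "complex \<Rightarrow> complex"
  assume S: "finite S \<and> S \<subseteq> \<D>"
  let ?t = "\<lambda>n. p n * norm (\<Sum>x\<in>S. c x * x ^ n) ^ 2"
  have "(\<lambda>n. \<Sum>x\<in>S. \<Sum>y\<in>S. c x * cnj (c y) * (of_real (p n) * (cnj y * x) ^ n)) sums
      (\<Sum>x\<in>S. \<Sum>y\<in>S. c x * cnj (c y) * diagonal_kernel p x y)"
    by (intro sums_sum sums_mult diagonal_kernel_sums p) (use S in auto)
  also have "(\<lambda>n. \<Sum>x\<in>S. \<Sum>y\<in>S. c x * cnj (c y) * (of_real (p n) * (cnj y * x) ^ n))
      = (\<lambda>n. of_real (?t n))"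
    unfolding of_real_mult complex_norm_square cnj_sum complex_cnj_mult complex_cnj_power sum_product
    by (simp add: sum_distrib_left power_mult_distrib mult_ac)
  finally have *: "(\<lambda>n. complex_of_real (?t n)) sums
      (\<Sum>x\<in>S. \<Sum>y\<in>S. c x * cnj (c y) * diagonal_kernel p x y)" .
  then have "summable (\<lambda>n. complex_of_real (?t n))" by (rule sums_summable)
  then have "summable ?t" by (subst (asm) summable_of_real_iff)
  then have "(\<Sum>x\<in>S. \<Sum>y\<in>S. c x * cnj (c y) * diagonal_kernel p x y) = of_real (suminf ?t)"
    by (rule sums_unique2[OF * sums_of_real[OF summable_sums]])
  moreover have "suminf ?t \<ge> 0"
    by (rule suminf_nonneg[OF \<open>summable ?t\<close>]) (use p in simp)
  ultimately show "(\<Sum>x\<in>S. \<Sum>y\<in>S. c x * cnj (c y) * diagonal_kernel p x y) \<in> \<real>\<^sub>\<ge>\<^sub>0" by simp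
qed

text \<open>Comparing Taylor coefficients and cancelling \<open>p n\<close> makes all moments of
  \<open>c\<close> at the points \<open>cnj y\<close> vanish, hence all pairings with polynomials.
  The polynomial vanishing at every other point of \<open>S\<close> isolates
  \<open>c y\<close>.\<close>

lemma diagonal_kernel_independent:
  assumes p: "\<And>n. 0 < p n" "\<And>r. 0 \<le> r \<Longrightarrow> r < 1 \<Longrightarrow> summable (\<lambda>n. p n * r ^ n)"
    and S: "finite S" "S \<subseteq> \<D>" and zero: "\<And>x. x \<in> \<D> \<Longrightarrow> (\<Sum>y\<in>S. c y * diagonal_kernel p x y) = 0"
    and y: "y \<in> S"
  shows "c y = 0"
proof -
  have sums: "(\<lambda>n. (of_real (p n) * (\<Sum>y\<in>S. c y * cnj y ^ n)) * x ^ n) sums 0" if x: "x \<in> \<D>" for x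
  proof -
    have "(\<lambda>n. \<Sum>y\<in>S. c y * (of_real (p n) * (cnj y * x) ^ n)) sums (\<Sum>y\<in>S. c y * diagonal_kernel p x y)"
      by (intro sums_sum sums_mult diagonal_kernel_sums p x less_imp_le[OF p(1)]) (use S in auto)
    then show ?thesis
      by (simp add: zero[OF x] sum_distrib_left sum_distrib_right power_mult_distrib mult_ac)
  qed
  have "(\<lambda>n. of_real (p n) * (\<Sum>y\<in>S. c y * cnj y ^ n)) = taylor_coeff (\<lambda>x. 0)"
    by (rule taylor_coeff_unique[symmetric]) (rule sums)
  also have "\<dots> = (\<lambda>n. 0)" by (rule taylor_coeff_unique) simp
  finally have moments: "(\<Sum>y\<in>S. c y * cnj y ^ n) = 0" for n
    using fun_cong[of _ _ n] p(1)[of n] by fastforce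
  have poly_zero: "(\<Sum>y\<in>S. c y * poly q (cnj y)) = 0" for q
  proof -
    have "(\<Sum>y\<in>S. c y * poly q (cnj y)) = (\<Sum>i\<le>degree q. coeff q i * (\<Sum>y\<in>S. c y * cnj y ^ i))"
      unfolding poly_altdef sum_distrib_left by (subst sum.swap) (simp add: mult_ac)
    then show ?thesis by (simp add: moments)
  qed
  define q where "q = (\<Prod>z\<in>S - {y}. [:- cnj z, 1:])"
  have "poly q (cnj x) = 0" if "x \<in> S" "x \<noteq> y" for x
    using that S by (auto simp: q_def poly_prod)
  then have "(\<Sum>x\<in>S. c x * poly q (cnj x)) = c y * poly q (cnj y)"
    using S(1) y by (simp add: sum.remove[OF S(1) y])
  moreover have "poly q (cnj y) \<noteq> 0"
    using S by (auto simp: q_def poly_prod)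
  ultimately show ?thesis using poly_zero[of q] by simp
qed

text \<open>The witnesses are the diagonal kernel of Kaluza's sequence \<open>c\<close> and the
  constant function 1. The product identity \<open>renewal\<close> yields both the quotient formula
  and the absence of zeros.\<close>

lemma CNP_diagonal_kernel:
  fixes b :: "nat \<Rightarrow> real"
  assumes b0: "b 0 = 1" and pos: "\<And>n. 0 < b n"
    and logconv: "\<And>n. b (Suc n) ^ 2 \<le> b n * b (Suc (Suc n))"
    and summable: "\<And>r. 0 \<le> r \<Longrightarrow> r < 1 \<Longrightarrow> summable (\<lambda>n. b n * r ^ n)"
  shows "CNP_kernel \<D> (diagonal_kernel b)"
proof -
  obtain c where c: "c 0 = 0" "\<And>n. 0 \<le> c n" "\<And>n. c n \<le> b n"
    "\<And>n. n > 0 \<Longrightarrow> b n = (\<Sum>k\<le>n. c k * b (n - k))"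
    using Kaluza[of b, OF b0 pos logconv] by blast
  have b_nonneg: "0 \<le> b n" for n using pos[of n] by simp
  have c_summable: "summable (\<lambda>n. c n * r ^ n)" if "0 \<le> r" "r < 1" for r
    by (rule summable_comparison_test'[OF summable[OF that]])
      (use c that in \<open>simp add: mult_right_mono\<close>)
  have renewal: "(\<Sum>n. of_real (b n) * x ^ n) * (1 - (\<Sum>n. of_real (c n) * x ^ n)) = 1"
    if x: "norm x < 1" for x :: complex
  proof -
    let ?B = "\<lambda>n. of_real (b n) * x ^ n" and ?C = "\<lambda>n. of_real (c n) * x ^ n"
    have B: "summable (\<lambda>n. norm (?B n))" and C: "summable (\<lambda>n. norm (?C n))"
      using summable_norm_powser x b_nonneg summable c c_summable by blast+
    have "(\<lambda>n. \<Sum>k\<le>n. ?C k * ?B (n - k)) sums (suminf ?C * suminf ?B)"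
      by (rule Cauchy_product_sums[OF C B])
    \<comment> \<open>The correction at 0 reflects \<open>c 0 = 0\<close> and
      \<open>b 0 = 1\<close>; it produces the constant 1 in the identity.\<close>
    moreover have "(\<Sum>k\<le>n. ?C k * ?B (n - k)) = ?B n - (if n = 0 then 1 else 0)" for n
    proof -
      have "(\<Sum>k\<le>n. ?C k * ?B (n - k)) = of_real (\<Sum>k\<le>n. c k * b (n - k)) * x ^ n"
        unfolding of_real_sum sum_distrib_right
        by (intro sum.cong refl) (simp add: power_add[symmetric] mult_ac)
      then show ?thesis using c(1) c(4)[of n] b0 by (cases "n = 0") auto
    qed
    moreover have "(\<lambda>n. ?B n - (if n = 0 then 1 else 0)) sums (suminf ?B - 1)"
      using sums_diff[OF summable_sums[OF summable_norm_cancel[OF B]] sums_single[of 0 "\<lambda>_. 1"]] by simp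
    ultimately have "suminf ?C * suminf ?B = suminf ?B - 1"
      using sums_unique2 by simp
    then show ?thesis by (simp add: algebra_simps)
  qed
  have norm_less: "norm (\<Sum>n. of_real (c n) * x ^ n :: complex) < 1" if x: "norm x < 1" for x :: complex
  proof -
    define r where "r = norm x"
    have r: "0 \<le> r" "r < 1" using x by (auto simp: r_def)
    have "norm (\<Sum>n. of_real (c n) * x ^ n) \<le> (\<Sum>n. norm (of_real (c n) * x ^ n))"
      by (rule summable_norm) (use summable_norm_powser x c c_summable in blast)
    also have "\<dots> = (\<Sum>n. c n * r ^ n)" using c by (simp add: norm_mult norm_power r_def)
    also have "\<dots> < 1"
    proof -
      \<comment> \<open>At the real point \<open>r\<close> the identity has product 1 and a
        nonnegative first factor, so the second factor is positive.\<close>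
      have "complex_of_real ((\<Sum>n. b n * r ^ n) * (1 - (\<Sum>n. c n * r ^ n))) = of_real 1"
        using renewal[of "of_real r"] r suminf_of_real[OF summable[OF r], where 'a = complex]
          suminf_of_real[OF c_summable[OF r], where 'a = complex] by simp
      then have "(\<Sum>n. b n * r ^ n) * (1 - (\<Sum>n. c n * r ^ n)) = 1"
        by (simp only: of_real_eq_iff)
      moreover have "(\<Sum>n. b n * r ^ n) \<ge> 0"
        by (rule suminf_nonneg[OF summable[OF r]]) (use b_nonneg r in simp)
      ultimately have "1 - (\<Sum>n. c n * r ^ n) > 0"
        by (metis less_numeral_extra(1) zero_less_mult_pos2 mult_eq_0_iff not_less order_less_le zero_less_mult_pos)
      then show ?thesis by simp
    qed
    finally show ?thesis .
  qed
  have eq: "diagonal_kernel b x y * (1 - diagonal_kernel c x y) = 1" if "x \<in> \<D>" "y \<in> \<D>" for x y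
    unfolding diagonal_kernel_def by (rule renewal) (use mult_cnj_in_disc that in blast)
  show ?thesis
    unfolding CNP_kernel_def
  proof (intro conjI)
    show "irreducible_kernel \<D> (diagonal_kernel b)"
      unfolding irreducible_kernel_def
    proof (intro conjI allI ballI impI)
      show "pos_semidef \<D> (diagonal_kernel b)"
        by (rule pos_semidef_diagonal_kernel[OF b_nonneg summable])
      show "diagonal_kernel b x y \<noteq> 0" if "x \<in> \<D>" "y \<in> \<D>" for x y
        using eq[OF that] by auto
      show "v y = 0" if "finite S \<and> S \<subseteq> \<D> \<and> (\<forall>x\<in>\<D>. (\<Sum>y\<in>S. v y * diagonal_kernel b x y) = 0)" "y \<in> S"
        for S v y
        using diagonal_kernel_independent[of b S v y, OF pos summable] that by blast
    qed
    have "pos_semidef \<D> (diagonal_kernel c)"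
      by (rule pos_semidef_diagonal_kernel[OF c(2) c_summable])
    moreover have "norm (diagonal_kernel c x y) < 1" if "x \<in> \<D>" "y \<in> \<D>" for x y
      unfolding diagonal_kernel_def by (rule norm_less) (use mult_cnj_in_disc that in blast)
    moreover have "diagonal_kernel b x y = cnj 1 * 1 / (1 - diagonal_kernel c x y)" if "x \<in> \<D>" "y \<in> \<D>" for x y
      using eq[OF that] by (metis complex_cnj_one mult_1 mult_zero_right nonzero_eq_divide_eq zero_neq_one)
    ultimately show "\<exists>F \<delta>. pos_semidef \<D> F \<and> (\<forall>x\<in>\<D>. \<forall>y\<in>\<D>. norm (F x y) < 1) \<and> (\<forall>x\<in>\<D>. \<delta> x \<noteq> 0) \<and>
       (\<forall>x\<in>\<D>. \<forall>y\<in>\<D>. diagonal_kernel b x y = cnj (\<delta> x) * \<delta> y / (1 - F x y))"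
      by (intro exI[of _ "diagonal_kernel c"] exI[of _ "\<lambda>_. 1"]) auto
  qed
qed

section \<open>Choice of the weights and conclusion for the Dirichlet kernel\<close>

theorem theorem3:
  fixes d :: nat
    and H :: "(complex \<Rightarrow> complex) set"
    and ip :: "(complex \<Rightarrow> complex) \<Rightarrow> (complex \<Rightarrow> complex) \<Rightarrow> complex"
  assumes "d > 0"
    and "is_dirichlet_power_space d H ip"
  shows "\<exists>ip' K. hilbert_function_space \<D> H ip' \<and>
           equivalent_norms H (ip_norm ip) (ip_norm ip') \<and>
           reproducing_kernel \<D> H ip' K \<and>
           CNP_kernel \<D> K"
proof -
  obtain m where d: "d = Suc m" using assms(1) by (cases d) auto
  define C where "C = 4 * real m + 1"
  have C: "C \<ge> 1" "4 * real m + 1 \<le> C" by (auto simp: C_def)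
  define w where "w n = (harm n + C) ^ m / real (n + 1)" for n
  have w_pos: "w n > 0" for n
    using harm_nonneg[of n, where 'a = real] C by (simp add: w_def)
  from dirichlet_power_coeffs[OF C(1), of m] obtain a l u where lu: "0 < l" "0 < u"
    and bounds: "\<And>n. l * w n \<le> a n" "\<And>n. a n \<le> u * w n"
    and sums: "\<And>x::complex. norm x < 1 \<Longrightarrow>
       (\<lambda>n. of_real (a n) * x ^ n) sums (\<Sum>n. x ^ n / of_nat (n + 1)) ^ d"
    unfolding w_def d by blast
  \<comment> \<open>Kaluza's lemma needs \<open>b 0 = 1\<close>; the scaling keeps log-convexity and
    only multiplies the comparison constants by \<open>w 0\<close>.\<close>
  define b where "b n = w n / w 0" for n
  have a_pos: "0 < a n" for n
    using less_le_trans[OF mult_pos_pos[OF lu(1) w_pos] bounds(1)] .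
  have b_pos: "0 < b n" for n using w_pos by (simp add: b_def)
  have a_summable: "summable (\<lambda>n. a n * r ^ n)" if "0 \<le> r" "r < 1" for r
  proof -
    have "summable (\<lambda>n. complex_of_real (a n * r ^ n))"
      using sums_summable[OF sums[of "of_real r"]] that by simp
    then show ?thesis by (subst (asm) summable_of_real_iff)
  qed
  have kernel: "dirichlet_kernel w z ^ d = diagonal_kernel a w z" if "z \<in> \<D>" "w \<in> \<D>" for w z
    using sums_unique[OF sums[OF mult_cnj_in_disc[OF that]]]
    by (simp add: dirichlet_kernel_def diagonal_kernel_def)
  interpret hilbert_function_space \<D> H ip
    using assms(2) by (simp add: is_dirichlet_power_space_def)
  interpret diagonal_kernel_space H ip a
  proof
    show "f holomorphic_on \<D>" if "f \<in> H" for f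
      using assms(2) that by (simp add: is_dirichlet_power_space_def)
    \<comment> \<open>The kernels have been compared only on the disc; the cut-off in
      \<open>kernel_fun\<close> makes the kernel functions equal everywhere.\<close>
    have "kernel_fun \<D> (\<lambda>w z. dirichlet_kernel w z ^ d) y = kernel_fun \<D> (diagonal_kernel a) y"
      if "y \<in> \<D>" for y
      using kernel[OF that] unfolding kernel_fun_def by fastforce
    then show "reproducing_kernel \<D> H ip (diagonal_kernel a)"
      using assms(2) unfolding is_dirichlet_power_space_def reproducing_kernel_def by auto
  qed (use a_pos a_summable in auto)
  have b_bounds: "l * w 0 * b n \<le> a n" "a n \<le> u * w 0 * b n" for n
    using bounds[of n] w_pos[of 0] by (auto simp: b_def)
  have lu': "0 < l * w 0" "0 < u * w 0" using lu w_pos by auto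
  have "summable (\<lambda>n. b n * r ^ n)" if "0 \<le> r" "r < 1" for r
  proof (rule summable_comparison_test')
    show "summable (\<lambda>n. 1 / (l * w 0) * (a n * r ^ n))" by (intro summable_mult a_summable that)
    show "norm (b n * r ^ n) \<le> 1 / (l * w 0) * (a n * r ^ n)" for n
    proof -
      have "b n \<le> 1 / (l * w 0) * a n"
        using b_bounds(1)[of n] lu' by (simp add: field_simps)
      from mult_right_mono[OF this, of "r ^ n"] show ?thesis
        using that b_pos[of n] by (simp add: mult.assoc)
    qed
  qed
  moreover have "b (Suc n) ^ 2 \<le> b n * b (Suc (Suc n))" for n
    using harm_power_log_convex[OF C(2), of n] w_pos[of 0]
    unfolding b_def w_def[symmetric]
    by (simp add: power_divide power2_eq_square divide_right_mono)
  moreover have "b 0 = 1" using w_pos[of 0] by (simp add: b_def)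
  ultimately have "CNP_kernel \<D> (diagonal_kernel b)"
    using b_pos by (intro CNP_diagonal_kernel)
  then show ?thesis
    using equivalent_diagonal_norm[OF lu' b_pos b_bounds] by blast
qed

end
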